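(* Let $q=p^e$ with $p$ prime, and let $m\ge4$ be an integer with $(m,q)\neq(4,2)$ and $2\mid em$. Let $\gamma$ be a primitive element of $\mathbb{F}_{q^m}$. Let $N\neq1$ be a proper divisor of $q^m-1$ such that $p^{\ell_1}\equiv-1\pmod N$ for some positive integer $\ell_1$; choose $\ell_1$ minimal and write $em=2\ell_1t$. Let $J\subsetneq\mathbb{Z}_N$ be a proper subset of size $u$. If $q$ is odd, assume further that $N\mid\frac{q^m-1}{2}$ and $J+\frac{q^m-1}{2}\equiv J\pmod N$. For $0\le i\le N-1$ let $C_i=\{\gamma^{jN+i}:0\le j\le\frac{q^m-1}{N}-1\}$, and let $D=\bigcup_{j\in J}C_j$. If $J$ is invariant under the map $\rho:j\mapsto j+\frac{q^m-1}{q-1}\pmod N$ and one of the following holds: (1) $t$ is odd, $u\neq\dfrac{\sqrt{q^m}\,N}{\sqrt{q^m}+1}$ and $u>\dfrac{N}{\sqrt{q^m}+1}$; (2) $t$ is even and $u>\dfrac{(q-1)\sqrt{q^m}\,N}{(\sqrt{q^m}+q)(\sqrt{q^m}-1)}$; then the code $\mathcal C(M_D)$ is a minimal linear code.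
   Context: $\mathrm{Tr}=\mathrm{Tr}_{\mathbb{F}_{q^m}/\mathbb{F}_q}$. Code: fix an ordering $x_1,\dots,x_{q^m-1}$ of $\mathbb{F}_{q^m}^*$, let $f_D$ be the characteristic function of $D$ ($1$ on $D$, $0$ elsewhere, in $\mathbb{F}_q$), and for $(u',v)\in\mathbb{F}_q\times\mathbb{F}_{q^m}$ let $c(u',v)=(u'f_D(x_i)+\mathrm{Tr}(vx_i))_{1\le i\le q^m-1}$; $\mathcal C(M_D)=\{c(u',v)\}$. A linear code is minimal if whenever codewords $c,c'$ satisfy $\mathrm{supp}(c')\subseteq\mathrm{supp}(c)$ (supports = sets of nonzero coordinates), $c'=\lambda c$ for some $\lambda\in\mathbb{F}_q$. *)

theory Defs
  imports
    Complex_Main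
    "HOL-Computational_Algebra.Primes"
    "HOL-Number_Theory.Cong"
    "HOL-Library.Cardinality"
    "HOL-Library.Indicator_Function"
    "Jordan_Normal_Form.Matrix"
begin

text \<open>
  The field with \<open>q ^ m\<close> elements is a type of class \<open>finite_field\<close>; the field with \<open>q\<close> elements
  is the subfield of that type with \<open>q\<close> elements.
\<close>

definition is_subfield :: "'a::field set \<Rightarrow> bool" where
  "is_subfield F \<longleftrightarrow> 0 \<in> F \<and> 1 \<in> F \<and>
     (\<forall>a\<in>F. \<forall>b\<in>F. a - b \<in> F) \<and>
     (\<forall>a\<in>F. \<forall>b\<in>F. a * b \<in> F) \<and>
     (\<forall>a\<in>F. inverse a \<in> F)"

definition primitive_element :: "'a::finite_field \<Rightarrow> bool" where
  "primitive_element \<gamma> \<longleftrightarrow> range (\<lambda>k::nat. \<gamma> ^ k) = UNIV - {0}"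

text \<open>
  The relative trace from the field with \<open>q ^ m\<close> elements to its subfield with \<open>q\<close> elements, as
  the sum of the conjugates under the Frobenius map; its values are taken in the large field.
\<close>

definition field_trace :: "nat \<Rightarrow> nat \<Rightarrow> 'a::finite_field \<Rightarrow> 'a" where
  "field_trace q m y = (\<Sum>i<m. y ^ (q ^ i))"

definition cyclotomic_class :: "'a::finite_field \<Rightarrow> nat \<Rightarrow> nat \<Rightarrow> 'a set" where
  "cyclotomic_class \<gamma> N i = {\<gamma> ^ (j * N + i) | j. j < (CARD('a) - 1) div N}"

definition linear_code :: "'a::field set \<Rightarrow> nat \<Rightarrow> 'a vec set \<Rightarrow> bool" where
  "linear_code F n C \<longleftrightarrow>
     (\<forall>c\<in>C. c \<in> carrier_vec n \<and> (\<forall>i<n. c $ i \<in> F)) \<and>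
     0\<^sub>v n \<in> C \<and>
     (\<forall>c\<in>C. \<forall>d\<in>C. c + d \<in> C) \<and>
     (\<forall>a\<in>F. \<forall>c\<in>C. a \<cdot>\<^sub>v c \<in> C)"

definition vec_supp :: "'a::zero vec \<Rightarrow> nat set" where
  "vec_supp c = {i. i < dim_vec c \<and> c $ i \<noteq> 0}"

definition minimal_linear_code :: "'a::field set \<Rightarrow> nat \<Rightarrow> 'a vec set \<Rightarrow> bool" where
  "minimal_linear_code F n C \<longleftrightarrow> linear_code F n C \<and>
     (\<forall>c\<in>C. \<forall>c'\<in>C. vec_supp c' \<subseteq> vec_supp c \<longrightarrow> (\<exists>a\<in>F. c' = a \<cdot>\<^sub>v c))"

text \<open>
  The coordinates are indexed by \<open>{..<q ^ m - 1}\<close> through an enumeration \<open>x\<close> of the nonzero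
  elements of the field.
\<close>

definition code_of_set ::
  "'a::finite_field set \<Rightarrow> nat \<Rightarrow> nat \<Rightarrow> (nat \<Rightarrow> 'a) \<Rightarrow> 'a set \<Rightarrow> 'a vec set" where
  "code_of_set F q m x D =
     {vec (q ^ m - 1) (\<lambda>i. u' * indicator D (x i) + field_trace q m (v * x i)) | u' v. u' \<in> F}"

end

theory Submission
  imports Defs "HOL-Computational_Algebra.Polynomial"
begin

text \<open>
  Put \<open>r = p ^ l\<^sub>1\<close> and \<open>s = r ^ t\<close>, so that the field has \<open>s\<^sup>2\<close> elements, and let \<open>\<chi>\<close> be a
  nontrivial additive character. Since \<open>N\<close> divides \<open>r + 1\<close>, the set \<open>D\<close> is invariant under
  nonzero \<open>(r + 1)\<close>-th powers, and its character sums are averages of the Hermitian sums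
  \<open>S b = (\<Sum>y. \<chi> (b * y ^ (r + 1)))\<close>. Expanding \<open>(S b)\<^sup>2\<close> gives \<open>s\<^sup>2\<close>, or \<open>(s * r)\<^sup>2\<close> for \<open>b\<close> in one
  exceptional coset of the \<open>(r + 1)\<close>-th powers; the sign of \<open>S b\<close> follows from
  \<open>S b \<equiv> 1 (mod r + 1)\<close>. Hence a hyperplane \<open>T (v * x) = 0\<close>, \<open>T\<close> the trace, meets \<open>D\<close> in
  one of only two cardinalities.

  A violation of minimality forces \<open>D\<close> into a special position with respect to one or two
  hyperplanes: the complement of \<open>D\<close> lies in a hyperplane, \<open>D\<close> misses a hyperplane, \<open>D\<close> and its
  complement are both confined by two hyperplanes, or, for \<open>q = 2\<close>, \<open>D\<close> meets a hyperplane in an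
  affine one. Each position is refuted by comparing cardinalities; in the two-hyperplane case
  the difference of two intersection numbers would be too large.
\<close>

section \<open>Finite fields and additive characters\<close>

declare One_nat_def [simp del]

text \<open>The polynomial \<open>X^n - X\<close> has at most \<open>n\<close> roots, and
  \<open>A\<close> already supplies that many. This identifies both the prime field and
  \<open>F\<close> with the fixed points of a Frobenius power.\<close>

lemma eq_power_fixed_points:
  fixes A :: "'a::idom set"
  assumes "finite A" "card A = n" "n \<ge> 2" "\<And>x. x \<in> A \<Longrightarrow> x ^ n = x"
  shows "A = {x. x ^ n = x}"
proof -
  let ?f = "Polynomial.monom 1 n - Polynomial.monom 1 1 :: 'a poly"
  have "coeff ?f n = 1" using assms by simp
  then have "?f \<noteq> 0" by (metis coeff_0 zero_neq_one)
  have "degree ?f \<le> n"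
    using assms by (intro degree_diff_le) (auto simp: degree_monom_eq)
  moreover have eq: "{x. poly ?f x = 0} = {x. x ^ n = x}"
    by (auto simp: poly_monom)
  ultimately have "card {x::'a. x ^ n = x} \<le> n"
    using card_poly_roots_bound[OF \<open>?f \<noteq> 0\<close>] by simp
  moreover have "finite {x::'a. x ^ n = x}"
    using poly_roots_finite[OF \<open>?f \<noteq> 0\<close>] eq by simp
  moreover have "A \<subseteq> {x. x ^ n = x}" using assms by auto
  ultimately show ?thesis using assms by (intro card_seteq) auto
qed

text \<open>The polynomial is nonzero because only \<open>i = 0\<close> contributes to the
  coefficient of \<open>X\<close>, and its degree is too small for it to vanish on all of
  \<open>A\<close>. Applied to the whole field and to \<open>F\<close>, this shows that their traces
  to the prime field are not identically zero.\<close>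

lemma additive_polynomial_nonzero:
  fixes A :: "'a::idom set"
  assumes "finite A" "b \<ge> 2" "n \<ge> 1" "b ^ (n - 1) < card A"
  shows "\<exists>y\<in>A. (\<Sum>i<n. y ^ (b ^ i)) \<noteq> 0"
proof (rule ccontr)
  assume neg: "\<not> ?thesis"
  let ?f = "\<Sum>i<n. Polynomial.monom 1 (b ^ i) :: 'a poly"
  have one_iff: "b ^ i = 1 \<longleftrightarrow> i = 0" for i
    using power_inject_exp[of b i 0] \<open>b \<ge> 2\<close> by simp
  have "coeff ?f 1 = (\<Sum>i<n. if i = 0 then 1 else 0)"
    unfolding coeff_sum coeff_monom using \<open>b \<ge> 2\<close> by (intro sum.cong) (auto simp: one_iff)
  also have "\<dots> = 1" using \<open>n \<ge> 1\<close> by (auto simp: sum.delta)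
  finally have "?f \<noteq> 0" by (metis coeff_0 zero_neq_one)
  have "degree ?f \<le> b ^ (n - 1)"
  proof (rule degree_sum_le)
    fix i assume "i \<in> {..<n}"
    then have "b ^ i \<le> b ^ (n - 1)" using \<open>b \<ge> 2\<close> by (intro power_increasing) auto
    then show "degree (Polynomial.monom (1::'a) (b ^ i)) \<le> b ^ (n - 1)"
      by (simp add: degree_monom_eq)
  qed simp
  moreover have "A \<subseteq> {x. poly ?f x = 0}" using neg by (auto simp: poly_sum poly_monom)
  then have "card A \<le> card {x. poly ?f x = 0}"
    using poly_roots_finite[OF \<open>?f \<noteq> 0\<close>] by (intro card_mono) auto
  ultimately show False using card_poly_roots_bound[OF \<open>?f \<noteq> 0\<close>] assms(4) by linarith
qed

text \<open>Translation by \<open>c\<close> permutes \<open>A\<close> and multiplies the sum by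
  \<open>g c\<close>.\<close>

lemma sum_character_eq_0:
  fixes g :: "'a::ab_group_add \<Rightarrow> 'b::idom"
  assumes "\<And>a b. a \<in> A \<Longrightarrow> b \<in> A \<Longrightarrow> a - b \<in> A"
    and "\<And>a b. a \<in> A \<Longrightarrow> b \<in> A \<Longrightarrow> g (a + b) = g a * g b"
    and "c \<in> A" "g c \<noteq> 1"
  shows "sum g A = 0"
proof -
  have "0 \<in> A" using assms(1)[OF \<open>c \<in> A\<close> \<open>c \<in> A\<close>] by simp
  then have "- c \<in> A" using assms(1)[of 0 c] \<open>c \<in> A\<close> by simp
  then have plus: "a + c \<in> A" if "a \<in> A" for a using assms(1)[OF that, of "- c"] by simp
  have "sum g A = (\<Sum>a\<in>A. g (a + c))"
    by (rule sum.reindex_bij_witness[of _ "\<lambda>a. a + c" "\<lambda>a. a - c"])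
       (use assms(1) \<open>c \<in> A\<close> plus in auto)
  also have "\<dots> = g c * sum g A"
    using assms(2) \<open>c \<in> A\<close> by (simp add: sum_distrib_left mult.commute)
  finally show ?thesis using \<open>g c \<noteq> 1\<close> by (simp add: mult_cancel_right1)
qed

section \<open>Powers of a primitive element and roots of unity\<close>

locale field_generator =
  fixes \<gamma> :: "'a::finite_field"
  assumes primitive: "primitive_element \<gamma>"
begin

lemma generator_nonzero: "\<gamma> \<noteq> 0"
  using primitive unfolding primitive_element_def by (metis Diff_iff insertI1 power_one_right rangeI)

lemma obtain_power:
  assumes "x \<noteq> 0"
  obtains k where "x = \<gamma> ^ k"
  using primitive assms unfolding primitive_element_def by (metis Diff_iff UNIV_I image_iff singletonD)

lemma card_field_gt_1: "CARD('a) > 1"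
  using card_mono[of UNIV "{0, 1 :: 'a}"] by simp

lemma power_card_minus_1: "x \<noteq> 0 \<Longrightarrow> x ^ (CARD('a) - 1) = (1::'a)"
  using finite_field_power_card_eq_same[of x] card_field_gt_1
  by (metis One_nat_def Suc_diff_1 bot_nat_0.extremum_strict less_nat_zero_code mult_cancel_left1 not_gr_zero power_Suc)

lemma generator_power_mod: "\<gamma> ^ (k mod (CARD('a) - 1)) = \<gamma> ^ k"
proof -
  have "\<gamma> ^ k = \<gamma> ^ ((CARD('a) - 1) * (k div (CARD('a) - 1)) + k mod (CARD('a) - 1))" by simp
  also have "\<dots> = \<gamma> ^ (k mod (CARD('a) - 1))"
    unfolding power_add power_mult power_card_minus_1[OF generator_nonzero] by simp
  finally show ?thesis ..
qed

lemma bij_betw_generator_power: "bij_betw (\<lambda>k. \<gamma> ^ k) {..<CARD('a) - 1} (UNIV - {0})"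
proof -
  have "(\<lambda>k. \<gamma> ^ k) ` {..<CARD('a) - 1} = UNIV - {0}"
  proof (intro equalityI subsetI)
    fix x :: 'a assume "x \<in> UNIV - {0}"
    then obtain k where "x = \<gamma> ^ k" using obtain_power by blast
    then have "x = \<gamma> ^ (k mod (CARD('a) - 1))" using generator_power_mod by simp
    moreover have "k mod (CARD('a) - 1) < CARD('a) - 1" using card_field_gt_1 by simp
    ultimately show "x \<in> (\<lambda>k. \<gamma> ^ k) ` {..<CARD('a) - 1}" by blast
  qed (use generator_nonzero in auto)
  moreover have "card (UNIV - {0::'a}) = CARD('a) - 1" by simp
  ultimately show ?thesis
    unfolding bij_betw_def by (metis card_lessThan eq_card_imp_inj_on finite_lessThan)
qed

lemma generator_power_eq_iff: "\<gamma> ^ i = \<gamma> ^ j \<longleftrightarrow> [i = j] (mod (CARD('a) - 1))"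
proof
  assume "\<gamma> ^ i = \<gamma> ^ j"
  then have "\<gamma> ^ (i mod (CARD('a) - 1)) = \<gamma> ^ (j mod (CARD('a) - 1))"
    by (simp add: generator_power_mod)
  then show "[i = j] (mod (CARD('a) - 1))"
    using bij_betw_generator_power card_field_gt_1 unfolding bij_betw_def cong_def inj_on_def by simp
qed (metis cong_def generator_power_mod)

lemma generator_power_eq_1_iff: "\<gamma> ^ i = 1 \<longleftrightarrow> (CARD('a) - 1) dvd i"
  using generator_power_eq_iff[of i 0] by (simp add: cong_0_iff)

text \<open>If \<open>w = \<gamma> ^ i\<close>, then \<open>w ^ k = 1\<close> makes
  \<open>d * k\<close> divide \<open>i * k\<close>, so \<open>d\<close> divides
  \<open>i\<close>.\<close>

lemma root_of_unity_is_power: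
  fixes w :: "'a"
  assumes "d * k = CARD('a) - 1" "w ^ k = 1"
  obtains y where "y \<noteq> 0" "w = y ^ d"
proof -
  have "k > 0" using assms(1) card_field_gt_1 by (cases k) auto
  then have "w \<noteq> 0" using assms(2) by (auto simp: zero_power)
  then obtain i where i: "w = \<gamma> ^ i" by (rule obtain_power)
  then have "d * k dvd i * k" using assms generator_power_eq_1_iff[of "i * k"] by (simp add: power_mult)
  then have "d dvd i" using \<open>k > 0\<close> by simp
  then obtain j where "i = d * j" ..
  then have "w = (\<gamma> ^ j) ^ d" by (simp add: i mult.commute flip: power_mult)
  then show thesis using generator_nonzero by (intro that[of "\<gamma> ^ j"]) auto
qed

lemma card_roots_of_unity:
  assumes "d dvd CARD('a) - 1"
  shows "card {y::'a. y ^ d = 1} = d"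
proof -
  obtain k where k: "CARD('a) - 1 = d * k" using assms ..
  have "d > 0" "k > 0" using k card_field_gt_1 by (metis mult_0 mult_0_right not_gr_zero zero_less_diff)+
  have "{y::'a. y ^ d = 1} = (\<lambda>i. \<gamma> ^ (k * i)) ` {..<d}"
  proof safe
    fix y :: 'a assume "y ^ d = 1"
    then have "y \<noteq> 0" using \<open>d > 0\<close> by (auto simp: zero_power)
    then have "y \<in> (\<lambda>k. \<gamma> ^ k) ` {..<CARD('a) - 1}"
      using bij_betw_generator_power by (simp add: bij_betw_def)
    then obtain i where i: "i < d * k" "y = \<gamma> ^ i" using k by auto
    then have "d * k dvd i * d" using \<open>y ^ d = 1\<close> k generator_power_eq_1_iff[of "i * d"]
      by (simp add: power_mult)
    then have "k dvd i" using \<open>d > 0\<close> by (simp add: mult.commute)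
    then obtain j where j: "i = k * j" ..
    then have "j < d" using i \<open>k > 0\<close> by (simp add: mult.commute)
    then show "y \<in> (\<lambda>i. \<gamma> ^ (k * i)) ` {..<d}" using i j by auto
  next
    fix i
    have "(\<gamma> ^ (k * i)) ^ d = (\<gamma> ^ (CARD('a) - 1)) ^ i"
      unfolding k by (simp add: mult_ac flip: power_mult)
    then show "(\<gamma> ^ (k * i)) ^ d = 1"
      unfolding power_card_minus_1[OF generator_nonzero] by simp
  qed
  moreover have "inj_on (\<lambda>i. \<gamma> ^ (k * i)) {..<d}"
  proof (rule inj_onI)
    fix i j assume ij: "i \<in> {..<d}" "j \<in> {..<d}" "\<gamma> ^ (k * i) = \<gamma> ^ (k * j)"
    then have "k * i < CARD('a) - 1" "k * j < CARD('a) - 1" using k \<open>k > 0\<close> by (auto simp: mult.commute)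
    then have "k * i = k * j"
      using ij(3) bij_betw_generator_power unfolding bij_betw_def inj_on_def by (meson lessThan_iff)
    then show "i = j" using \<open>k > 0\<close> by simp
  qed
  ultimately show ?thesis by (simp add: card_image)
qed

text \<open>Every nonempty fibre of \<open>y \<mapsto> y ^ d\<close> over a nonzero element is a
  coset of the group of \<open>d\<close>-th roots of unity. This is the source of the congruence
  modulo \<open>r + 1\<close> that settles the sign of \<open>S b\<close>.\<close>

lemma dvd_card_power_fibres:
  assumes "d dvd CARD('a) - 1" "\<not> R 0"
  shows "d dvd card {y::'a. R (y ^ d)}"
proof -
  have "d > 0" using assms(1) card_field_gt_1 by (metis dvd_0_left_iff not_gr_zero zero_less_diff less_irrefl)
  have "card {y::'a. R (y ^ d)} = card (\<Union>z\<in>{z. R z}. {y::'a. z = y ^ d})"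
    by (rule arg_cong[where f = card]) auto
  also have "\<dots> = (\<Sum>z | R z. card {y::'a. z = y ^ d})"
    by (rule card_UN_disjoint) auto
  also have "d dvd \<dots>"
  proof (rule dvd_sum)
    fix z :: 'a assume "z \<in> {z. R z}"
    then have "z \<noteq> 0" using assms by auto
    show "d dvd card {y::'a. z = y ^ d}"
    proof (cases "\<exists>y. z = y ^ d")
      case True
      then obtain y0 where y0: "z = y0 ^ d" ..
      then have "y0 \<noteq> 0" using \<open>z \<noteq> 0\<close> \<open>d > 0\<close> by (metis power_0_left not_gr_zero)
      have "bij_betw (\<lambda>y. y0 * y) {y. y ^ d = 1} {y. z = y ^ d}"
        by (rule bij_betwI[where g = "\<lambda>y. y / y0"])
           (use \<open>y0 \<noteq> 0\<close> \<open>z \<noteq> 0\<close> \<open>d > 0\<close> y0 in \<open>auto simp: power_mult_distrib power_divide zero_power\<close>)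
      then show ?thesis using card_roots_of_unity[OF assms(1)] bij_betw_same_card by force
    qed auto
  qed
  finally show ?thesis .
qed

end

lemma sum_lessThan_mult:
  "(\<Sum>k<n * l. f k) = (\<Sum>j<n. \<Sum>i<l. f (j * l + i))" for l n :: nat
proof -
  have "(\<Sum>k<n * l. f k) = (\<Sum>j<n. sum f {0 + j * l..<l + j * l})"
    using sum.nat_group[of f l n] by (simp add: add.commute)
  also have "\<dots> = (\<Sum>j<n. \<Sum>i<l. f (j * l + i))"
    unfolding sum.shift_bounds_nat_ivl by (simp add: atLeast0LessThan add.commute)
  finally show ?thesis .
qed

lemma minus_1_dvd_power_minus_1_nat: "x - 1 dvd x ^ n - (1::nat)"
proof (cases "x = 0")
  case False
  have "[x ^ n = 1 ^ n] (mod (x - 1))"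
    using False by (intro cong_pow) (simp add: cong_altdef_nat)
  then show ?thesis using False by (simp add: cong_altdef_nat)
qed (cases n, auto)

section \<open>The absolute trace and the canonical additive character\<close>

locale semiprimitive = field_generator \<gamma> for \<gamma> :: "'a::finite_field" +
  fixes p l t :: nat
  assumes prime_p: "prime p" and l_pos: "l > 0" and t_pos: "t > 0"
    and card_field: "CARD('a) = p ^ (2 * l * t)"
begin

definition "r = p ^ l"
definition "s = r ^ t"
definition Tr :: "'a \<Rightarrow> 'a" where "Tr = field_trace p (2 * l * t)"

lemma p_ge_2: "p \<ge> 2" using prime_p by (rule prime_ge_2_nat)

lemma r_ge_2: "r \<ge> 2"
proof -
  have "p ^ 1 \<le> p ^ l" using p_ge_2 l_pos by (intro power_increasing) auto
  then show ?thesis using p_ge_2 by (simp add: r_def)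
qed

lemma s_pos: "s > 0" using r_ge_2 by (simp add: s_def)

lemma card_eq_r: "CARD('a) = r ^ (2 * t)"
  by (simp add: card_field r_def mult_ac flip: power_mult)

lemma card_eq_s: "CARD('a) = s\<^sup>2"
  by (simp add: card_eq_r s_def mult.commute flip: power_mult)

text \<open>Summing \<open>x + 1\<close> and summing \<open>x\<close> over the field give the same
  value, so the cardinality of the field, a power of \<open>p\<close>, vanishes in it.\<close>

lemma CHAR_eq: "CHAR('a) = p"
proof -
  have "(\<Sum>x\<in>UNIV. x + 1 :: 'a) = \<Sum>UNIV"
    by (rule sum.reindex_bij_witness[of _ "\<lambda>x. x - 1" "\<lambda>x. x + 1"]) auto
  then have "of_nat CARD('a) = (0 :: 'a)" by (simp add: sum.distrib)
  then have "CHAR('a) dvd p ^ (2 * l * t)" using of_nat_eq_0_iff_char_dvd[where ?'a = 'a] card_field by metis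
  then have "CHAR('a) dvd p" using prime_dvd_power CHAR_prime by blast
  then show ?thesis using prime_p by (metis CHAR_prime primes_dvd_imp_eq)
qed

lemma add_power: "(x + y :: 'a) ^ (p ^ k) = x ^ (p ^ k) + y ^ (p ^ k)"
  by (rule freshmans_dream') (use prime_p in \<open>auto simp: CHAR_eq\<close>)

lemma sum_power: "(sum f A :: 'a) ^ (p ^ k) = (\<Sum>i\<in>A. f i ^ (p ^ k))"
  by (rule freshmans_dream_sum') (use prime_p in \<open>auto simp: CHAR_eq\<close>)

lemma of_nat_power_p: "(of_nat k :: 'a) ^ p = of_nat k"
  using sum_power[of "\<lambda>_. 1" "{..<k}" 1] by simp

lemma of_nat_eq_iff_mod: "(of_nat i :: 'a) = of_nat j \<longleftrightarrow> [i = j] (mod p)"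
  using of_nat_eq_iff_cong_CHAR[where ?'a = 'a] by (simp add: CHAR_eq)

lemma prime_field_eq: "of_nat ` {..<p} = {x::'a. x ^ p = x}"
proof (rule eq_power_fixed_points)
  have "inj_on (of_nat :: nat \<Rightarrow> 'a) {..<p}"
    by (auto simp: inj_on_def of_nat_eq_iff_mod cong_def)
  then show "card ((of_nat :: nat \<Rightarrow> 'a) ` {..<p}) = p" by (simp add: card_image)
qed (use p_ge_2 of_nat_power_p in auto)

lemma Tr_add: "Tr (x + y) = Tr x + Tr y"
  by (simp add: Tr_def field_trace_def add_power sum.distrib)

lemma Tr_0 [simp]: "Tr 0 = 0"
  using Tr_add[of 0 0] by (metis add.right_neutral add_left_cancel)

lemma Tr_of_nat_mult: "Tr (of_nat k * x) = of_nat k * Tr x"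
  by (induction k) (simp_all add: Tr_add algebra_simps)

text \<open>Frobenius shifts the conjugates by one place: the sum loses \<open>x\<close> at the
  bottom and gains \<open>x ^ CARD('a) = x\<close> at the top.\<close>

lemma Tr_p_power: "Tr (x ^ p) = Tr x"
proof -
  have "Tr (x ^ p) + x = (\<Sum>i<Suc (2 * l * t). x ^ (p ^ i))"
    unfolding sum.lessThan_Suc_shift Tr_def field_trace_def
    by (simp flip: power_mult power_Suc)
  also have "\<dots> = Tr x + x"
    using finite_field_power_card_eq_same[of x] by (simp add: Tr_def field_trace_def card_field)
  finally show ?thesis by simp
qed

lemma Tr_r_power: "Tr (x ^ r) = Tr x"
proof -
  have "Tr (x ^ (p ^ k)) = Tr x" for k
    by (induction k arbitrary: x) (simp_all add: Tr_p_power power_mult)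
  then show ?thesis by (simp add: r_def)
qed

lemma Tr_in_prime_field: "Tr x \<in> of_nat ` {..<p}"
proof -
  have "Tr x ^ p = Tr (x ^ p)"
    using sum_power[of "\<lambda>i. x ^ (p ^ i)" "{..<2 * l * t}" 1]
    by (simp add: Tr_def field_trace_def mult.commute flip: power_mult)
  then show ?thesis by (simp add: prime_field_eq Tr_p_power)
qed

text \<open>Trace values are elements of the large field; the representative below \<open>p\<close>
  serves as an exponent of the complex root of unity \<open>\<zeta>\<close>.\<close>

definition tr_nat :: "'a \<Rightarrow> nat" where
  "tr_nat x = (SOME k. k < p \<and> of_nat k = Tr x)"

lemma tr_nat: "tr_nat x < p" "of_nat (tr_nat x) = Tr x"
proof -
  have "\<exists>k. k < p \<and> of_nat k = Tr x" using Tr_in_prime_field[of x] by force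
  then have "tr_nat x < p \<and> of_nat (tr_nat x) = Tr x" unfolding tr_nat_def by (rule someI_ex)
  then show "tr_nat x < p" "of_nat (tr_nat x) = Tr x" by auto
qed

lemma tr_nat_eq_iff: "k < p \<Longrightarrow> tr_nat x = k \<longleftrightarrow> Tr x = of_nat k"
  using tr_nat[of x] of_nat_eq_iff_mod[of "tr_nat x" k] by (auto simp: cong_def)

definition "\<zeta> = cis (2 * pi / real p)"
definition \<chi> :: "'a \<Rightarrow> complex" where "\<chi> x = \<zeta> ^ tr_nat x"

lemma zeta_power: "\<zeta> ^ k = cis (2 * pi * real k / real p)"
  by (simp add: \<zeta>_def DeMoivre mult_ac)

lemma zeta_power_mod: "\<zeta> ^ (k mod p) = \<zeta> ^ k"
proof -
  have "\<zeta> ^ p = 1" using p_ge_2 by (simp add: zeta_power)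
  moreover have "\<zeta> ^ k = \<zeta> ^ (p * (k div p) + k mod p)" by simp
  ultimately show ?thesis unfolding power_add power_mult by simp
qed

lemma zeta_bij: "bij_betw (\<lambda>k. \<zeta> ^ k) {..<p} {z. z ^ p = 1}"
  unfolding zeta_power using p_ge_2 by (intro bij_betw_roots_unity) auto

lemma sum_zeta: "(\<Sum>k<p. \<zeta> ^ k) = 0"
  using sum.reindex_bij_betw[OF zeta_bij, of "\<lambda>z. z"] sum_roots_unity[of p] p_ge_2 by simp

lemma zeta_power_neq_1: "0 < k \<Longrightarrow> k < p \<Longrightarrow> \<zeta> ^ k \<noteq> 1"
  using zeta_bij p_ge_2 unfolding bij_betw_def inj_on_def
  by (metis lessThan_iff less_irrefl power_0 gr0I less_trans)

lemma chi_add: "\<chi> (x + y) = \<chi> x * \<chi> y"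
proof -
  have "(of_nat (tr_nat (x + y)) :: 'a) = of_nat (tr_nat x + tr_nat y)"
    by (simp add: tr_nat Tr_add)
  then have "tr_nat (x + y) mod p = (tr_nat x + tr_nat y) mod p"
    by (simp only: of_nat_eq_iff_mod cong_def)
  then show ?thesis unfolding \<chi>_def by (metis power_add zeta_power_mod)
qed

lemma chi_eq_1: "Tr x = 0 \<Longrightarrow> \<chi> x = 1"
  using tr_nat_eq_iff[of 0 x] p_ge_2 by (simp add: \<chi>_def)

lemma chi_0 [simp]: "\<chi> 0 = 1"
  by (simp add: chi_eq_1)

lemma chi_neq_1: "Tr x \<noteq> 0 \<Longrightarrow> \<chi> x \<noteq> 1"
  using tr_nat[of x] zeta_power_neq_1[of "tr_nat x"] unfolding \<chi>_def by (metis gr0I of_nat_0)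

lemma cnj_chi: "cnj (\<chi> x) = \<chi> (- x)"
proof -
  have "norm (\<chi> x) = 1" by (simp add: \<chi>_def zeta_power)
  then have "cnj (\<chi> x) * \<chi> x = 1" 
    using complex_norm_square[of "\<chi> x"] by (simp add: mult.commute)
  moreover have "\<chi> (- x) * \<chi> x = 1" by (simp flip: chi_add)
  ultimately show ?thesis by (metis mult_cancel_right mult_zero_right zero_neq_one)
qed

lemma chi_r_power: "\<chi> (x ^ r) = \<chi> x"
  by (simp add: \<chi>_def tr_nat_def Tr_r_power)

lemma sum_chi: "(\<Sum>y\<in>UNIV. \<chi> (c * y)) = (if c = 0 then of_nat CARD('a) else 0)"
proof (cases "c = 0")
  case False
  have "2 * l * t \<ge> 1" using l_pos t_pos by (simp add: Suc_le_eq One_nat_def)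
  moreover from this have "p ^ (2 * l * t - 1) < CARD('a)"
    unfolding card_field using p_ge_2 by (intro power_strict_increasing) auto
  ultimately obtain y where "Tr y \<noteq> 0"
    using additive_polynomial_nonzero[of "UNIV :: 'a set" p "2 * l * t"] p_ge_2
    by (auto simp: Tr_def field_trace_def)
  then have "\<chi> (c * (y / c)) \<noteq> 1" using False chi_neq_1 by simp
  then have "(\<Sum>y\<in>UNIV. \<chi> (c * y)) = 0"
    by (intro sum_character_eq_0[where c = "y / c"]) (auto simp: chi_add distrib_left)
  then show ?thesis using False by simp
qed simp

end

section \<open>Semiprimitive Gauss sums\<close>

context semiprimitive
begin

text \<open>\<open>S b\<close> does not change when \<open>b\<close> is multiplied by a nonzero
  \<open>(r + 1)\<close>-th power, so it depends only on the coset of \<open>b\<close>.\<close>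

definition S :: "'a \<Rightarrow> complex" where "S b = (\<Sum>y\<in>UNIV. \<chi> (b * y ^ (r + 1)))"

text \<open>These are the \<open>b\<close> for which the form \<open>b * y ^ (r + 1)\<close>
  degenerates: the additive map in \<open>S_square\<close> then has a nonzero kernel. They turn out
  to be a single coset of the \<open>(r + 1)\<close>-th powers.\<close>

definition special :: "'a set" where
  "special = {b. b \<noteq> 0 \<and> (\<exists>z. z \<noteq> 0 \<and> (b * z ^ (r + 1)) ^ r = - (b * z ^ (r + 1)))}"

lemma r_factor: "(r + 1) * (r - 1) = r * r - 1"
  using r_ge_2 by (simp add: algebra_simps)

lemma r_squared_dvd: "r * r - 1 dvd CARD('a) - 1"
  using minus_1_dvd_power_minus_1_nat[of "r * r" t]
  by (simp add: card_eq_r power_mult power2_eq_square)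

lemma Suc_r_dvd: "r + 1 dvd CARD('a) - 1"
  using r_squared_dvd r_factor by (metis dvd_mult_left)

text \<open>The nonzero elements of the subfield of order \<open>r\<close> are
  \<open>(r - 1)\<close>-th roots of unity, and \<open>(r + 1) * (r - 1)\<close> divides the order
  of the multiplicative group, since the degree over that subfield is even.\<close>

lemma fixed_by_r_is_power:
  fixes c :: 'a
  assumes "c \<noteq> 0" "c ^ r = c"
  obtains y where "y \<noteq> 0" "c = y ^ (r + 1)"
proof -
  obtain k where "CARD('a) - 1 = (r + 1) * ((r - 1) * k)"
    using r_squared_dvd r_factor by (metis dvd_def mult.assoc)
  moreover have "c ^ (r - 1) = 1"
  proof -
    have "c * c ^ (r - 1) = c" using assms(2) r_ge_2 by (simp flip: power_Suc)
    then show ?thesis using assms(1) by simp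
  qed
  then have "c ^ ((r - 1) * k) = 1" by (simp add: power_mult)
  ultimately show thesis using root_of_unity_is_power[of "r + 1" "(r - 1) * k" c] that by metis
qed

lemma r_power_add: "(x + y :: 'a) ^ r = x ^ r + y ^ r"
  unfolding r_def by (rule add_power)

lemma of_nat_power_r: "(of_nat k :: 'a) ^ r = of_nat k"
proof -
  have "(of_nat k :: 'a) ^ (p ^ i) = of_nat k" for i
    by (induction i) (simp_all add: power_mult of_nat_power_p)
  then show ?thesis by (simp add: r_def)
qed

text \<open>Each nonzero \<open>k\<close> in the prime field is an \<open>(r + 1)\<close>-th power,
  so all nonzero trace values are taken equally often, and the nontrivial powers of
  \<open>\<zeta>\<close> add up to \<open>- 1\<close>. The frequencies are multiples of
  \<open>r + 1\<close>; the summand 1 comes from \<open>y = 0\<close>.\<close>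

lemma S_integer:
  obtains n :: int where "S b = of_int n" "[n = 1] (mod int (r + 1))"
proof -
  define A where "A k = {y. y \<noteq> 0 \<and> tr_nat (b * y ^ (r + 1)) = k}" for k
  have dvd: "r + 1 dvd card (A k)" for k
  proof -
    have "A k = {y. y ^ (r + 1) \<noteq> 0 \<and> tr_nat (b * y ^ (r + 1)) = k}" by (auto simp: A_def)
    then show ?thesis
      using dvd_card_power_fibres[OF Suc_r_dvd, of "\<lambda>z. z \<noteq> 0 \<and> tr_nat (b * z) = k"] by simp
  qed
  have card_A: "card (A k) = card (A 1)" if k: "0 < k" "k < p" for k
  proof -
    have nz: "(of_nat k :: 'a) \<noteq> 0"
      using of_nat_eq_iff_mod[of k 0] k by (auto simp: cong_def)
    \<comment> \<open>Scaling \<open>y\<close> by this root of \<open>k\<close> scales the trace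
      value by \<open>k\<close>, which matches \<open>A 1\<close> with \<open>A k\<close>.\<close>
    then obtain g where g: "g \<noteq> 0" "(of_nat k :: 'a) = g ^ (r + 1)"
      using fixed_by_r_is_power of_nat_power_r by metis
    have eq: "b * (g * y) ^ (r + 1) = of_nat k * (b * y ^ (r + 1))" for y
      unfolding g(2) power_mult_distrib by (simp only: mult_ac)
    have A_iff: "y \<in> A i \<longleftrightarrow> y \<noteq> 0 \<and> Tr (b * y ^ (r + 1)) = of_nat i" if "i < p" for y i
      using tr_nat_eq_iff[OF that] by (simp add: A_def)
    have "g * y \<in> A k \<longleftrightarrow> y \<in> A 1" for y
    proof -
      have "g * y \<in> A k \<longleftrightarrow> g * y \<noteq> 0 \<and> of_nat k * Tr (b * y ^ (r + 1)) = of_nat k * 1"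
        using k by (simp only: A_iff eq Tr_of_nat_mult mult_1_right)
      also have "\<dots> \<longleftrightarrow> y \<in> A 1"
        using g(1) nz p_ge_2 A_iff[of 1] by (simp only: mult_cancel_left mult_eq_0_iff) simp
      finally show ?thesis .
    qed
    then have "\<And>y. y \<in> A 1 \<Longrightarrow> g * y \<in> A k" "\<And>y. y \<in> A k \<Longrightarrow> y / g \<in> A 1"
      using g(1) by (metis, metis nonzero_mult_div_cancel_left times_divide_eq_right)
    then have "bij_betw (\<lambda>y. g * y) (A 1) (A k)"
      by (intro bij_betwI[where g = "\<lambda>y. y / g"]) (use g(1) in \<open>auto simp del: power_mult_distrib\<close>)
    then show ?thesis by (metis bij_betw_same_card)
  qed
  have "S b = 1 + (\<Sum>y\<in>UNIV - {0}. \<zeta> ^ tr_nat (b * y ^ (r + 1)))"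
    unfolding S_def by (subst sum.remove[of _ 0]) (auto simp: zero_power \<chi>_def [symmetric])
  also have "(\<Sum>y\<in>UNIV - {0}. \<zeta> ^ tr_nat (b * y ^ (r + 1)))
      = (\<Sum>k<p. \<Sum>y | y \<in> UNIV - {0} \<and> tr_nat (b * y ^ (r + 1)) = k. \<zeta> ^ tr_nat (b * y ^ (r + 1)))"
    by (rule sum.group[symmetric]) (auto simp: tr_nat)
  also have "\<dots> = (\<Sum>k<p. of_nat (card (A k)) * \<zeta> ^ k)"
    by (intro sum.cong) (auto simp: A_def)
  also have "\<dots> = of_nat (card (A 0)) + (\<Sum>k\<in>{..<p} - {0}. of_nat (card (A k)) * \<zeta> ^ k)"
    using p_ge_2 by (subst sum.remove[of _ 0]) auto
  also have "(\<Sum>k\<in>{..<p} - {0}. of_nat (card (A k)) * \<zeta> ^ k)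
      = of_nat (card (A 1)) * (\<Sum>k\<in>{..<p} - {0}. \<zeta> ^ k)"
    unfolding sum_distrib_left
  proof (rule sum.cong[OF refl])
    fix k assume "k \<in> {..<p} - {0}"
    then have "card (A k) = card (A 1)" by (intro card_A) auto
    then show "of_nat (card (A k)) * \<zeta> ^ k = of_nat (card (A 1)) * \<zeta> ^ k" by (simp only:)
  qed
  also have "(\<Sum>k\<in>{..<p} - {0}. \<zeta> ^ k) = - 1"
    using sum_zeta p_ge_2 by (subst (asm) sum.remove[of _ 0]) (auto simp: add_eq_0_iff)
  finally have "S b = of_int (1 + int (card (A 0)) - int (card (A 1)))" by simp
  moreover have "int (r + 1) dvd int (card (A 0)) - int (card (A 1))"
    using dvd by (intro dvd_diff) (auto simp only: int_dvd_int_iff)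
  then have "[1 + int (card (A 0)) - int (card (A 1)) = 1] (mod int (r + 1))"
    by (simp add: cong_iff_dvd_diff)
  ultimately show thesis by (rule that)
qed

text \<open>The trace splits into \<open>2 * t\<close> blocks of \<open>l\<close> conjugates.
  Raising to the power \<open>r\<close> moves a block to the next one and negates it, so the blocks
  cancel in pairs.\<close>

lemma chi_antifixed:
  assumes "w ^ r = - w"
  shows "\<chi> w = 1"
proof -
  define h where "h j = (\<Sum>i<l. w ^ (p ^ (j * l + i)))" for j
  have "h j + h (Suc j) = 0" for j
  proof -
    have "w ^ (p ^ (j * l + i)) + w ^ (p ^ (Suc j * l + i)) = (w + w ^ r) ^ (p ^ (j * l + i))" for i
      unfolding add_power r_def by (simp add: power_add mult_ac flip: power_mult)
    then show ?thesis
      using assms p_ge_2 by (simp add: h_def zero_power flip: sum.distrib)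
  qed
  then have "(\<Sum>j<2 * k. h j) = 0" for k
    by (induction k) (simp_all add: add.assoc)
  then have "Tr w = 0"
    using sum_lessThan_mult[of "\<lambda>i. w ^ (p ^ i)" "2 * t" l]
    by (simp add: Tr_def field_trace_def h_def mult_ac)
  then show ?thesis by (rule chi_eq_1)
qed

lemma antifixed_iff:
  fixes b z :: 'a
  assumes "z \<noteq> 0"
  shows "b * z + b ^ r * (z ^ r) ^ r = 0 \<longleftrightarrow> (b * z ^ (r + 1)) ^ r = - (b * z ^ (r + 1))"
proof -
  have "(b * z ^ (r + 1)) ^ r + b * z ^ (r + 1) = z ^ r * (b * z + b ^ r * (z ^ r) ^ r)"
    by (simp add: power_add power_mult_distrib algebra_simps)
  then show ?thesis using assms by (metis add_eq_0_iff2 mult_eq_0_iff power_not_zero)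
qed

text \<open>After the substitution \<open>x = z + y\<close> in the double sum, the exponent is
  additive in \<open>y\<close> apart from a term in \<open>z\<close> alone, so the sum over
  \<open>y\<close> selects a kernel. On that kernel the remaining factor is 1 by
  \<open>chi_antifixed\<close>.\<close>

lemma S_square:
  assumes "b \<noteq> 0"
  shows "S b * S b = of_nat (CARD('a) * card {z. b * z + b ^ r * (z ^ r) ^ r = 0})"
proof -
  \<comment> \<open>The \<open>r\<close>-th root of \<open>b * z\<close>: since \<chi> is invariant
    under \<open>r\<close>-th powers, the term \<open>b * z * y ^ r\<close> may be replaced by
    \<open>c z * y\<close>, which is linear in \<open>y\<close>.\<close>
  define c where "c z = (b * z) ^ (r ^ (2 * t - 1))" for z
  have c_r: "c z ^ r = b * z" for z
  proof -
    have "r ^ (2 * t - 1) * r = CARD('a)"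
      using t_pos by (simp add: card_eq_r flip: power_Suc2)
    then have "c z ^ r = (b * z) ^ CARD('a)" unfolding c_def by (metis power_mult)
    then show ?thesis by (simp add: finite_field_power_card_eq_same)
  qed
  have zero_iff: "c z + b * z ^ r = 0 \<longleftrightarrow> b * z + b ^ r * (z ^ r) ^ r = 0" for z
  proof -
    have "(c z + b * z ^ r) ^ r = b * z + b ^ r * (z ^ r) ^ r"
      by (simp add: r_power_add c_r power_mult_distrib)
    then show ?thesis using r_ge_2 by (metis power_eq_0_iff zero_power gr0I not_numeral_le_zero)
  qed
  have chi_zy: "\<chi> (b * (z + y) ^ (r + 1)) * \<chi> (- (b * y ^ (r + 1)))
      = \<chi> (b * z ^ (r + 1)) * \<chi> ((c z + b * z ^ r) * y)" for y z
  proof -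
    have "b * (z + y) ^ (r + 1) + - (b * y ^ (r + 1))
        = (c z * y) ^ r + b * z ^ r * y + b * z ^ (r + 1)"
      by (simp add: power_add r_power_add power_mult_distrib c_r algebra_simps)
    then have "\<chi> (b * (z + y) ^ (r + 1)) * \<chi> (- (b * y ^ (r + 1)))
        = \<chi> ((c z * y) ^ r) * \<chi> (b * z ^ r * y) * \<chi> (b * z ^ (r + 1))"
      by (metis chi_add)
    also have "\<dots> = \<chi> (b * z ^ (r + 1)) * \<chi> ((c z + b * z ^ r) * y)"
      by (simp add: chi_r_power chi_add distrib_right)
    finally show ?thesis .
  qed
  obtain n where n: "S b = of_int n" using S_integer by blast
  \<comment> \<open>Being an integer, \<open>S b\<close> equals its conjugate, so its square is a
    squared modulus.\<close>
  then have "S b * S b = S b * cnj (S b)" by simp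
  also have "\<dots> = (\<Sum>y\<in>UNIV. \<Sum>x\<in>UNIV. \<chi> (b * x ^ (r + 1)) * \<chi> (- (b * y ^ (r + 1))))"
    unfolding S_def cnj_sum cnj_chi sum_product by (rule sum.swap)
  also have "\<dots> = (\<Sum>y\<in>UNIV. \<Sum>z\<in>UNIV. \<chi> (b * (z + y) ^ (r + 1)) * \<chi> (- (b * y ^ (r + 1))))"
  proof (rule sum.cong[OF refl])
    fix y :: 'a
    show "(\<Sum>x\<in>UNIV. \<chi> (b * x ^ (r + 1)) * \<chi> (- (b * y ^ (r + 1))))
        = (\<Sum>z\<in>UNIV. \<chi> (b * (z + y) ^ (r + 1)) * \<chi> (- (b * y ^ (r + 1))))"
      by (rule sum.reindex_bij_witness[of _ "\<lambda>z. z + y" "\<lambda>x. x - y"]) auto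
  qed
  also have "\<dots> = (\<Sum>z\<in>UNIV. \<chi> (b * z ^ (r + 1)) * (\<Sum>y\<in>UNIV. \<chi> ((c z + b * z ^ r) * y)))"
    unfolding chi_zy sum_distrib_left by (rule sum.swap)
  also have "\<dots> = (\<Sum>z\<in>UNIV. if b * z + b ^ r * (z ^ r) ^ r = 0 then of_nat CARD('a) else 0)"
  proof (rule sum.cong[OF refl])
    fix z :: 'a
    have "\<chi> (b * z ^ (r + 1)) = 1" if "b * z + b ^ r * (z ^ r) ^ r = 0"
    proof (cases "z = 0")
      case False
      then show ?thesis using that antifixed_iff chi_antifixed by blast
    qed (simp add: zero_power)
    then show "\<chi> (b * z ^ (r + 1)) * (\<Sum>y\<in>UNIV. \<chi> ((c z + b * z ^ r) * y))
        = (if b * z + b ^ r * (z ^ r) ^ r = 0 then of_nat CARD('a) else 0)"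
      by (simp add: sum_chi zero_iff)
  qed
  also have "\<dots> = of_nat (CARD('a) * card {z. b * z + b ^ r * (z ^ r) ^ r = 0})"
    by (simp add: sum.If_cases mult.commute)
  finally show ?thesis .
qed

lemma card_fixed_by_r_squared: "card {u::'a. (u ^ r) ^ r = u} = r\<^sup>2"
proof -
  have pos: "r * r > 0" using r_ge_2 by simp
  have "{u::'a. (u ^ r) ^ r = u} = insert 0 {u. u ^ (r * r - 1) = 1}"
  proof -
    have "(u ^ r) ^ r = u * u ^ (r * r - 1)" for u :: 'a
      using pos by (simp flip: power_mult power_Suc)
    then show ?thesis by auto
  qed
  moreover have "r * r - 1 > 0"
    using mult_le_mono[OF r_ge_2 r_ge_2] by linarith
  then have "(0::'a) \<notin> {u. u ^ (r * r - 1) = 1}" by (simp add: zero_power)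
  ultimately show ?thesis
    using card_roots_of_unity[OF r_squared_dvd] pos by (simp add: power2_eq_square)
qed

text \<open>A nonzero kernel element \<open>z0\<close> carries the subfield of order
  \<open>r\<^sup>2\<close> bijectively onto the kernel; without one the kernel is trivial.\<close>

lemma S_square_cases:
  assumes "b \<noteq> 0"
  shows "S b * S b = (if b \<in> special then of_nat ((s * r)\<^sup>2) else of_nat (s\<^sup>2))"
proof (cases "b \<in> special")
  case True
  then obtain z0 where z0: "z0 \<noteq> 0" "b * z0 + b ^ r * (z0 ^ r) ^ r = 0"
    unfolding special_def using antifixed_iff by blast
  have eq: "b * (z0 * u) + b ^ r * ((z0 * u) ^ r) ^ r = b * z0 * (u - (u ^ r) ^ r)" for u
  proof -
    have "b * (z0 * u) + b ^ r * ((z0 * u) ^ r) ^ r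
        = b * z0 * (u - (u ^ r) ^ r) + (b * z0 + b ^ r * (z0 ^ r) ^ r) * (u ^ r) ^ r"
      by (simp add: power_mult_distrib algebra_simps)
    then show ?thesis using z0 by simp
  qed
  have bij: "bij_betw (\<lambda>u. z0 * u) {u. (u ^ r) ^ r = u} {z. b * z + b ^ r * (z ^ r) ^ r = 0}"
  proof (rule bij_betwI[where g = "\<lambda>z. z / z0"])
    show "(\<lambda>z. z / z0) \<in> {z. b * z + b ^ r * (z ^ r) ^ r = 0} \<rightarrow> {u. (u ^ r) ^ r = u}"
    proof
      fix z assume "z \<in> {z. b * z + b ^ r * (z ^ r) ^ r = 0}"
      then show "z / z0 \<in> {u. (u ^ r) ^ r = u}"
        using eq[of "z / z0"] z0(1) assms by auto
    qed
  qed (use eq z0(1) in auto)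
  have "card {z. b * z + b ^ r * (z ^ r) ^ r = 0} = r\<^sup>2"
    using bij_betw_same_card[OF bij] card_fixed_by_r_squared by simp
  then show ?thesis
    using True S_square[OF assms] by (simp add: card_eq_s power_mult_distrib)
next
  case False
  then have "{z. b * z + b ^ r * (z ^ r) ^ r = 0} = {0}"
    using assms antifixed_iff r_ge_2 by (auto simp: special_def zero_power)
  then show ?thesis
    using False S_square[OF assms] by (simp add: card_eq_s)
qed

text \<open>The square fixes \<open>S b\<close> up to sign. Since \<open>r\<close> is
  \<open>- 1\<close> modulo \<open>r + 1\<close>, \<open>s\<close> is \<open>(- 1) ^ t\<close>
  there, and being congruent to 1 decides the sign.\<close>

lemma S_eq:
  assumes "b \<noteq> 0"
  shows "S b = (if b \<in> special then - ((- 1) ^ t * of_nat (s * r)) else (- 1) ^ t * of_nat s)"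
proof -
  define \<sigma> :: int where "\<sigma> = (- 1) ^ t"
  have sq: "\<sigma> * \<sigma> = 1" unfolding \<sigma>_def by (simp flip: power_add mult_2)
  obtain n where n: "S b = of_int n" "[n = 1] (mod int (r + 1))" by (rule S_integer)
  have r_cong: "[int r = - 1] (mod int (r + 1))" by (simp add: cong_iff_dvd_diff add.commute)
  have s_cong: "[int s = \<sigma>] (mod int (r + 1))"
    using cong_pow[OF r_cong] by (simp add: s_def \<sigma>_def)
  \<comment> \<open>The other sign would make 1 and \<open>- 1\<close> congruent modulo
    \<open>r + 1\<close>, which is at least 3.\<close>
  have solve: "n = \<sigma> * m" if m: "[m = \<sigma>] (mod int (r + 1))" "n * n = m * m" for m
  proof (rule ccontr)
    assume "n \<noteq> \<sigma> * m"
    moreover have "n = m \<or> n = - m" using m(2) by (simp add: square_eq_iff)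
    moreover have "\<sigma> = 1 \<or> \<sigma> = - 1" using sq by (simp add: square_eq_1_iff)
    ultimately have "n = - (\<sigma> * m)" by auto
    moreover have "[- (\<sigma> * m) = - (\<sigma> * \<sigma>)] (mod int (r + 1))"
      using m(1) by (intro cong_uminus cong_mult) auto
    ultimately have "[1 = - 1] (mod int (r + 1))"
      using n(2) sq by (metis cong_sym cong_trans)
    then have "int (r + 1) dvd 2" by (simp add: cong_iff_dvd_diff)
    then show False using r_ge_2 zdvd_imp_le[of "int (r + 1)" 2] by simp
  qed
  show ?thesis
  proof (cases "b \<in> special")
    case True
    have "[- (int s * int r) = - (\<sigma> * - 1)] (mod int (r + 1))"
      using s_cong r_cong by (intro cong_uminus cong_mult)
    moreover have "n * n = - (int s * int r) * - (int s * int r)"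
    proof -
      have "(of_int (n * n) :: complex) = of_int (int ((s * r)\<^sup>2))"
        using S_square_cases[OF assms] True by (simp add: n)
      then show ?thesis by (simp only: of_int_eq_iff) (simp add: power2_eq_square)
    qed
    ultimately have "n = \<sigma> * - (int s * int r)" by (intro solve) auto
    then show ?thesis using True by (simp add: n \<sigma>_def)
  next
    case False
    have "n * n = int s * int s"
    proof -
      have "(of_int (n * n) :: complex) = of_int (int (s\<^sup>2))"
        using S_square_cases[OF assms] False by (simp add: n)
      then show ?thesis by (simp only: of_int_eq_iff) (simp add: power2_eq_square)
    qed
    then have "n = \<sigma> * int s" using s_cong by (intro solve) auto
    then show ?thesis using False by (simp add: n \<sigma>_def)
  qed
qed

text \<open>The quotient of two elements negated by the \<open>r\<close>-th power map is fixed by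
  it, hence an \<open>(r + 1)\<close>-th power.\<close>

lemma special_coset:
  assumes "b \<in> special" "b' \<in> special"
  obtains y where "y \<noteq> 0" "b' = b * y ^ (r + 1)"
proof -
  obtain z where z: "z \<noteq> 0" "(b * z ^ (r + 1)) ^ r = - (b * z ^ (r + 1))"
    using assms by (auto simp: special_def)
  obtain z' where z': "z' \<noteq> 0" "(b' * z' ^ (r + 1)) ^ r = - (b' * z' ^ (r + 1))"
    using assms by (auto simp: special_def)
  have nz: "b \<noteq> 0" "b' \<noteq> 0" using assms by (auto simp: special_def)
  define c where "c = (b' * z' ^ (r + 1)) / (b * z ^ (r + 1))"
  have "c ^ r = c" unfolding c_def power_divide z z' by simp
  moreover have "c \<noteq> 0" using nz z z' by (simp add: c_def)
  ultimately obtain y where y: "y \<noteq> 0" "c = y ^ (r + 1)" using fixed_by_r_is_power by blast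
  have "b' * z' ^ (r + 1) = y ^ (r + 1) * (b * z ^ (r + 1))"
    using y(2) nz z unfolding c_def by (simp add: nonzero_divide_eq_eq)
  then have "b' = b * (y * z / z') ^ (r + 1)"
    using z'(1) unfolding power_divide power_mult_distrib
    by (simp add: nonzero_eq_divide_eq mult_ac del: power_Suc)
  then show thesis using y z z' by (intro that[of "y * z / z'"]) auto
qed

text \<open>Summed over all \<open>b\<close>, the \<open>S b\<close> give the field size, by
  orthogonality only \<open>y = 0\<close> contributing. This is also \<open>S 0\<close>, so the
  values at nonzero \<open>b\<close> cancel, a linear equation for the number of special
  elements.\<close>

lemma card_special: "(r + 1) * card special = CARD('a) - 1"
proof -
  have "(\<Sum>b\<in>UNIV - {0}. S b) = 0"
  proof -
    have "(\<Sum>b\<in>UNIV. S b) = (\<Sum>y\<in>UNIV. \<Sum>b\<in>UNIV. \<chi> (y ^ (r + 1) * b))"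
      unfolding S_def by (subst sum.swap) (simp add: mult.commute)
    also have "\<dots> = (\<Sum>y\<in>UNIV. if y = (0::'a) then of_nat CARD('a) else 0)"
      unfolding sum_chi by simp
    also have "\<dots> = of_nat CARD('a)" by simp
    also have "\<dots> = S 0" by (simp add: S_def)
    finally show ?thesis by (simp add: sum_diff1)
  qed
  moreover have "(\<Sum>b\<in>UNIV - {0}. S b)
      = (\<Sum>b\<in>UNIV - {0}. (- 1) ^ t * of_nat s * (1 - (if b \<in> special then of_nat (r + 1) else 0)))"
    by (intro sum.cong) (auto simp: S_eq algebra_simps)
  moreover have "\<dots> = (- 1) ^ t * of_nat s *
      (of_nat (CARD('a) - 1) - of_nat (card special * (r + 1)))"
  proof -
    have "(UNIV - {0}) \<inter> special = special" by (auto simp: special_def)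
    then show ?thesis
      by (simp add: sum_subtractf sum.If_cases flip: sum_distrib_left)
  qed
  ultimately have "(of_nat (CARD('a) - 1) :: complex) = of_nat (card special * (r + 1))"
    using s_pos by simp
  then show ?thesis by (simp only: of_nat_eq_iff mult.commute)
qed

text \<open>Averaging over multiplication by \<open>(r + 1)\<close>-th powers turns the character
  sum into a sum of values of \<open>S\<close>. As \<open>D\<close> is a union of cosets, it
  contains all or none of the \<open>x\<close> with \<open>v * x\<close> special;
  \<open>\<delta>\<close> records which.\<close>

lemma character_sum_invariant_set:
  assumes "0 \<notin> D" and invariant: "\<And>x y. x \<in> D \<Longrightarrow> y \<noteq> 0 \<Longrightarrow> x * y ^ (r + 1) \<in> D"
    and "v \<noteq> 0"
  obtains \<delta> :: real where "\<delta> = 0 \<or> \<delta> = 1"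
    "(\<Sum>x\<in>D. \<chi> (v * x))
      = of_real (real (card D) / (real s ^ 2 - 1) * ((- 1) ^ t * real s - 1) - (- 1) ^ t * real s * \<delta>)"
proof -
  define E where "E = {x \<in> D. v * x \<in> special}"
  define \<sigma> :: real where "\<sigma> = (- 1) ^ t"
  have "E = {} \<or> card E = card special"
  proof (cases "E = {}")
    case False
    then obtain x0 where x0: "x0 \<in> D" "v * x0 \<in> special" by (auto simp: E_def)
    have "bij_betw (\<lambda>x. v * x) E special"
    proof (rule bij_betwI[where g = "\<lambda>x. x / v"])
      show "(\<lambda>x. x / v) \<in> special \<rightarrow> E"
      proof
        fix b assume b: "b \<in> special"
        obtain y where "y \<noteq> 0" "b = v * x0 * y ^ (r + 1)" using special_coset[OF x0(2) b] .
        then show "b / v \<in> E" using b invariant[OF x0(1)] \<open>v \<noteq> 0\<close> by (simp add: E_def mult.assoc)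
      qed
    qed (use \<open>v \<noteq> 0\<close> in \<open>auto simp: E_def\<close>)
    then show ?thesis using bij_betw_same_card by blast
  qed simp
  then obtain \<delta> :: real where \<delta>: "\<delta> = 0 \<or> \<delta> = 1" "real (card E) = \<delta> * real (card special)"
    by (metis card.empty mult_cancel_right1 mult_zero_left of_nat_0)
  have Q1: "real (CARD('a) - 1) = real s ^ 2 - 1"
    using s_pos by (simp add: card_eq_s of_nat_diff)
  have Q1_pos: "real s ^ 2 - 1 > 0"
    using card_field_gt_1 unfolding Q1[symmetric] by simp
  have shift: "(\<Sum>x\<in>D. \<chi> (v * x)) = (\<Sum>x\<in>D. \<chi> (v * x * y ^ (r + 1)))" if "y \<noteq> 0" for y
  proof (rule sum.reindex_bij_witness[of _ "\<lambda>x. x * y ^ (r + 1)" "\<lambda>x. x * (1 / y) ^ (r + 1)"])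
    fix x assume "x \<in> D"
    have inv: "(1 / y) ^ (r + 1) * y ^ (r + 1) = 1"
      using that by (simp add: power_divide)
    then show "x * (1 / y) ^ (r + 1) * y ^ (r + 1) = x" "x * y ^ (r + 1) * (1 / y) ^ (r + 1) = x"
      by (simp_all only: mult.assoc mult.commute[of "y ^ (r + 1)"] mult_1_right)
    show "\<chi> (v * (x * (1 / y) ^ (r + 1)) * y ^ (r + 1)) = \<chi> (v * x)"
      by (simp only: mult.assoc inv mult_1_right)
    show "x * (1 / y) ^ (r + 1) \<in> D" "x * y ^ (r + 1) \<in> D"
      using that invariant \<open>x \<in> D\<close> by auto
  qed
  have "of_nat (CARD('a) - 1) * (\<Sum>x\<in>D. \<chi> (v * x)) = (\<Sum>y\<in>UNIV - {0}. \<Sum>x\<in>D. \<chi> (v * x * y ^ (r + 1)))"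
  proof -
    have "(\<Sum>y\<in>UNIV - {0}. \<Sum>x\<in>D. \<chi> (v * x * y ^ (r + 1))) = (\<Sum>y\<in>UNIV - {0::'a}. \<Sum>x\<in>D. \<chi> (v * x))"
      by (rule sum.cong[OF refl], rule shift[symmetric]) blast
    then show ?thesis by simp
  qed
  \<comment> \<open>The subtracted 1 is the term \<open>y = 0\<close> of \<open>S\<close>, absent
    from the average over nonzero \<open>y\<close>.\<close>
  also have "\<dots> = (\<Sum>x\<in>D. S (v * x) - 1)"
    by (subst sum.swap) (simp add: S_def sum_diff1 zero_power)
  also have "\<dots> = (\<Sum>x\<in>D. of_real (\<sigma> * s - 1 - (if v * x \<in> special then \<sigma> * s * (r + 1) else 0)))"
  proof (rule sum.cong[OF refl])
    fix x assume "x \<in> D"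
    then have "v * x \<noteq> 0" using assms by auto
    then show "S (v * x) - 1 = of_real (\<sigma> * s - 1 - (if v * x \<in> special then \<sigma> * s * (r + 1) else 0))"
      by (simp add: S_eq \<sigma>_def algebra_simps)
  qed
  also have "\<dots> = of_real (\<Sum>x\<in>D. \<sigma> * s - 1 - (if v * x \<in> special then \<sigma> * s * (r + 1) else 0))"
    by simp
  also have "(\<Sum>x\<in>D. \<sigma> * s - 1 - (if v * x \<in> special then \<sigma> * s * (r + 1) else 0))
      = card D * (\<sigma> * s - 1) - card E * (\<sigma> * s * (r + 1))"
  proof -
    have "D \<inter> {x. v * x \<in> special} = E" by (auto simp: E_def)
    then show ?thesis by (simp add: sum_subtractf sum.If_cases del: of_nat_add)
  qed
  also have "\<dots> = card D * (\<sigma> * s - 1) - \<sigma> * s * \<delta> * (real s ^ 2 - 1)"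
  proof -
    have special_eq: "real (r + 1) * real (card special) = real s ^ 2 - 1"
      using arg_cong[OF card_special, of real] Q1 by (simp only: of_nat_mult)
    show ?thesis unfolding \<delta>(2) special_eq[symmetric] by (simp only: mult_ac)
  qed
  also have "of_nat (CARD('a) - 1) = complex_of_real (real s ^ 2 - 1)"
    unfolding Q1[symmetric] by simp
  finally have eq: "complex_of_real (real s ^ 2 - 1) * (\<Sum>x\<in>D. \<chi> (v * x))
      = of_real (card D * (\<sigma> * s - 1) - \<sigma> * s * \<delta> * (real s ^ 2 - 1))" .
  have "complex_of_real (real s ^ 2 - 1) \<noteq> 0"
    unfolding of_real_eq_0_iff using Q1_pos by linarith
  then have "(\<Sum>x\<in>D. \<chi> (v * x)) = of_real (card D * (\<sigma> * s - 1) - \<sigma> * s * \<delta> * (real s ^ 2 - 1))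
      / of_real (real s ^ 2 - 1)"
    by (rule eq_divide_imp) (subst mult.commute, rule eq)
  also have "\<dots> = of_real ((card D * (\<sigma> * s - 1) - \<sigma> * s * \<delta> * (real s ^ 2 - 1)) / (real s ^ 2 - 1))"
    by (rule of_real_divide[symmetric])
  also have "(card D * (\<sigma> * s - 1) - \<sigma> * s * \<delta> * (real s ^ 2 - 1)) / (real s ^ 2 - 1)
     = card D / (real s ^ 2 - 1) * (\<sigma> * s - 1) - \<sigma> * s * \<delta>"
    using Q1_pos by (simp add: diff_divide_distrib)
  finally show thesis using \<delta>(1) that by (simp add: \<sigma>_def)
qed

end

section \<open>Hyperplane sections of invariant sets\<close>

locale semiprimitive_subfield = semiprimitive \<gamma> p l t
  for \<gamma> :: "'a::finite_field" and p l t :: nat +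
  fixes F :: "'a set" and e q m :: nat
  assumes e_pos: "e \<ge> 1" and q_eq: "q = p ^ e" and degree_eq: "e * m = 2 * l * t"
    and subfield: "is_subfield F" and card_F: "card F = q"
begin

definition T :: "'a \<Rightarrow> 'a" where "T = field_trace q m"

lemma
  shows F_0: "0 \<in> F" and F_1: "1 \<in> F"
    and F_diff: "a \<in> F \<Longrightarrow> b \<in> F \<Longrightarrow> a - b \<in> F"
    and F_mult: "a \<in> F \<Longrightarrow> b \<in> F \<Longrightarrow> a * b \<in> F"
    and F_inverse: "a \<in> F \<Longrightarrow> inverse a \<in> F"
  using subfield by (auto simp: is_subfield_def)

lemma F_uminus: "a \<in> F \<Longrightarrow> - a \<in> F"
  using F_diff[OF F_0] by force

lemma F_add: "a \<in> F \<Longrightarrow> b \<in> F \<Longrightarrow> a + b \<in> F"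
  using F_diff[of a "- b"] F_uminus by force

lemma F_divide: "a \<in> F \<Longrightarrow> b \<in> F \<Longrightarrow> a / b \<in> F"
  unfolding divide_inverse by (intro F_mult F_inverse)

lemma q_ge_2: "q \<ge> 2"
proof -
  have "p ^ 1 \<le> p ^ e" using p_ge_2 e_pos by (intro power_increasing) auto
  then show ?thesis using p_ge_2 by (simp add: q_eq)
qed

lemma card_eq_q: "CARD('a) = q ^ m"
  by (simp add: card_field q_eq degree_eq flip: power_mult)

text \<open>Multiplication by \<open>a\<close> permutes the nonzero elements of \<open>F\<close>;
  compare their products.\<close>

lemma F_unit_power: "a \<in> F \<Longrightarrow> a \<noteq> 0 \<Longrightarrow> a ^ (q - 1) = 1"
proof -
  assume a: "a \<in> F" "a \<noteq> 0"
  have "(\<Prod>y\<in>F - {0}. a * y) = \<Prod>(F - {0})"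
  proof (rule prod.reindex_bij_witness[of _ "\<lambda>y. y / a" "\<lambda>y. a * y"])
  qed (use a F_mult F_divide in auto)
  moreover have "(\<Prod>y\<in>F - {0}. a * y) = a ^ (q - 1) * \<Prod>(F - {0})"
    using F_0 card_F by (simp add: prod.distrib)
  ultimately show ?thesis by simp
qed

lemma F_power: "a \<in> F \<Longrightarrow> a ^ q = a"
proof (cases "a = 0")
  case False
  assume "a \<in> F"
  have "a ^ q = a * a ^ (q - 1)" using q_ge_2 by (simp flip: power_Suc)
  then show ?thesis using F_unit_power[OF \<open>a \<in> F\<close> False] by simp
qed (use q_ge_2 in \<open>simp add: zero_power\<close>)

lemma F_eq: "F = {x. x ^ q = x}"
  by (rule eq_power_fixed_points) (use card_F q_ge_2 F_power in auto)

lemma T_add: "T (x + y) = T x + T y"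
proof -
  have "(x + y) ^ (q ^ i) = x ^ (q ^ i) + y ^ (q ^ i)" for i
    using add_power[of x y "e * i"] by (simp add: q_eq power_mult)
  then show ?thesis by (simp add: T_def field_trace_def sum.distrib)
qed

lemma T_0 [simp]: "T 0 = 0"
  using T_add[of 0 0] by (metis add.right_neutral add_left_cancel)

lemma T_uminus: "T (- x) = - T x"
  using T_add[of x "- x"] by (metis T_0 add.right_inverse add_eq_0_iff)

lemma T_diff: "T (x - y) = T x - T y"
  using T_add[of x "- y"] by (simp add: T_uminus)

lemma T_mult:
  assumes "c \<in> F"
  shows "T (c * x) = c * T x"
proof -
  have "c ^ (q ^ i) = c" for i
    by (induction i) (simp_all add: power_mult F_power[OF assms])
  then show ?thesis by (simp add: T_def field_trace_def power_mult_distrib sum_distrib_left)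
qed

lemma T_in_F: "T x \<in> F"
proof -
  have "T x ^ q = (\<Sum>i<m. x ^ (q ^ Suc i))"
    using sum_power[of "\<lambda>i. x ^ (q ^ i)" "{..<m}" e]
    unfolding q_eq[symmetric] T_def field_trace_def by (simp add: mult.commute flip: power_mult)
  moreover have "(\<Sum>i<m. x ^ (q ^ Suc i)) + x = (\<Sum>i<Suc m. x ^ (q ^ i))"
    unfolding sum.lessThan_Suc_shift by simp
  moreover have "\<dots> = T x + x"
    using finite_field_power_card_eq_same[of x] by (simp add: T_def field_trace_def card_eq_q)
  ultimately show ?thesis by (simp add: F_eq)
qed

text \<open>Transitivity of the trace, by writing each Frobenius exponent as
  \<open>i * e + j\<close> with \<open>j < e\<close>.\<close>

lemma Tr_eq: "Tr x = (\<Sum>j<e. T x ^ (p ^ j))"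
proof -
  have "Tr x = (\<Sum>i<m. \<Sum>j<e. x ^ (p ^ (i * e + j)))"
    unfolding Tr_def field_trace_def degree_eq[symmetric] mult.commute[of e m]
    by (rule sum_lessThan_mult)
  also have "\<dots> = (\<Sum>j<e. \<Sum>i<m. x ^ (p ^ (i * e + j)))" by (rule sum.swap)
  also have "\<dots> = (\<Sum>j<e. T x ^ (p ^ j))"
    unfolding T_def field_trace_def sum_power
    by (simp add: q_eq power_add mult.commute flip: power_mult)
  finally show ?thesis .
qed

text \<open>Orthogonality on the additive group of \<open>F\<close>. It expresses the indicator of a
  hyperplane, up to the factor \<open>q\<close>, as a character sum, and all intersection counts
  rest on it.\<close>

lemma sum_chi_F: "(\<Sum>c\<in>F. \<chi> (c * z)) = (if T z = 0 then of_nat q else 0)"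
proof (cases "T z = 0")
  case True
  have "\<chi> (c * z) = 1" if "c \<in> F" for c
    using that True p_ge_2 by (intro chi_eq_1) (simp add: Tr_eq T_mult zero_power)
  then show ?thesis using True card_F by simp
next
  case False
  have "p ^ (e - 1) < card F"
    unfolding card_F q_eq using p_ge_2 e_pos by (intro power_strict_increasing) auto
  then obtain a where a: "a \<in> F" "(\<Sum>j<e. a ^ (p ^ j)) \<noteq> 0"
    using additive_polynomial_nonzero[of F p e] p_ge_2 e_pos by auto
  \<comment> \<open>Chosen so that \<open>T (c * z) = a\<close>, an element of \<open>F\<close> with
    nonzero trace to the prime field.\<close>
  define c where "c = a / T z"
  have c: "c \<in> F" unfolding c_def using a T_in_F by (intro F_divide)
  then have "Tr (c * z) \<noteq> 0" using a(2) False by (simp add: Tr_eq T_mult) (simp add: c_def)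
  then have "\<chi> (c * z) \<noteq> 1" by (rule chi_neq_1)
  then have "(\<Sum>c\<in>F. \<chi> (c * z)) = 0"
    using c F_diff by (intro sum_character_eq_0[where c = c]) (auto simp: chi_add distrib_right)
  then show ?thesis using False by simp
qed

lemma card_hyperplane:
  assumes "v \<noteq> 0"
  shows "q * card {x. T (v * x) = 0} = CARD('a)"
proof -
  have "of_nat (q * card {x. T (v * x) = 0}) = (\<Sum>x\<in>UNIV. \<Sum>c\<in>F. \<chi> (c * (v * x)))"
    unfolding sum_chi_F by (simp add: sum.If_cases mult.commute)
  also have "\<dots> = (\<Sum>c\<in>F. \<Sum>x\<in>UNIV. \<chi> (c * v * x))"
    by (subst sum.swap) (simp add: mult.assoc)
  also have "\<dots> = (\<Sum>c\<in>F. if c = 0 then of_nat CARD('a) else 0)"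
    unfolding sum_chi using assms by (intro sum.cong) auto
  also have "\<dots> = of_nat CARD('a)" using F_0 by (simp add: sum.delta)
  finally show ?thesis by (simp only: of_nat_eq_iff)
qed

text \<open>Expanding both indicators leaves only pairs with \<open>c * v + d * w = 0\<close>, and
  independence over \<open>F\<close> reduces these to \<open>c = d = 0\<close>.\<close>

lemma card_hyperplane_Int:
  assumes "v \<noteq> 0" "\<And>c. c \<in> F \<Longrightarrow> w \<noteq> c * v"
  shows "q * q * card {x. T (v * x) = 0 \<and> T (w * x) = 0} = CARD('a)"
proof -
  have indep: "c * v + d * w = 0 \<longleftrightarrow> c = 0 \<and> d = 0" if "c \<in> F" "d \<in> F" for c d
  proof (cases "d = 0")
    case False
    have "w = (- (c / d)) * v" if "c * v + d * w = 0"
      using that False by (simp add: field_simps add_eq_0_iff)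
    then show ?thesis using assms(2) that F_uminus F_divide False by blast
  qed (use assms in auto)
  have "of_nat (q * q * card {x. T (v * x) = 0 \<and> T (w * x) = 0})
      = (\<Sum>x\<in>UNIV. (if T (v * x) = 0 then of_nat q else 0) * (if T (w * x) = 0 then of_nat q else (0::complex)))"
  proof -
    have "(\<Sum>x\<in>UNIV. (if T (v * x) = 0 then of_nat q else 0) * (if T (w * x) = 0 then of_nat q else (0::complex)))
        = (\<Sum>x\<in>UNIV. if T (v * x) = 0 \<and> T (w * x) = 0 then of_nat q * of_nat q else 0)"
      by (intro sum.cong) auto
    then show ?thesis by (simp add: sum.If_cases mult.commute)
  qed
  also have "\<dots> = (\<Sum>x\<in>UNIV. \<Sum>c\<in>F. \<Sum>d\<in>F. \<chi> (c * (v * x)) * \<chi> (d * (w * x)))"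
    by (simp only: sum_product flip: sum_chi_F)
  also have "\<dots> = (\<Sum>c\<in>F. \<Sum>d\<in>F. \<Sum>x\<in>UNIV. \<chi> ((c * v + d * w) * x))"
    by (subst sum.swap, rule sum.cong[OF refl], subst sum.swap) (simp add: chi_add algebra_simps)
  also have "\<dots> = (\<Sum>c\<in>F. \<Sum>d\<in>F. if c = 0 then (if d = 0 then of_nat CARD('a) else 0) else 0)"
    unfolding sum_chi using indep by (intro sum.cong refl) auto
  also have "\<dots> = (\<Sum>c\<in>F. if c = 0 then of_nat CARD('a) else 0)"
    using F_0 by (intro sum.cong refl) (simp add: sum.delta)
  also have "\<dots> = of_nat CARD('a)" using F_0 by (simp add: sum.delta)
  finally show ?thesis by (simp only: of_nat_eq_iff)
qed

text \<open>In the expansion of the indicator, every nonzero \<open>c\<close> contributes the same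
  sum because \<open>c\<close> permutes \<open>D\<close>.\<close>

lemma card_invariant_hyperplane:
  assumes "\<And>c x. c \<in> F \<Longrightarrow> c \<noteq> 0 \<Longrightarrow> x \<in> D \<Longrightarrow> c * x \<in> D"
  shows "of_nat (q * card {x \<in> D. T (v * x) = 0})
    = of_nat (card D) + of_nat (q - 1) * (\<Sum>x\<in>D. \<chi> (v * x))"
proof -
  have "D \<inter> {x. T (v * x) = 0} = {x \<in> D. T (v * x) = 0}" by auto
  then have "of_nat (q * card {x \<in> D. T (v * x) = 0}) = (\<Sum>x\<in>D. \<Sum>c\<in>F. \<chi> (c * (v * x)))"
    unfolding sum_chi_F by (simp add: sum.If_cases mult.commute)
  also have "\<dots> = (\<Sum>c\<in>F. \<Sum>x\<in>D. \<chi> (c * (v * x)))" by (rule sum.swap)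
  also have "\<dots> = of_nat (card D) + (\<Sum>c\<in>F - {0}. \<Sum>x\<in>D. \<chi> (c * (v * x)))"
    using F_0 by (subst sum.remove[of _ 0]) auto
  also have "(\<Sum>c\<in>F - {0}. \<Sum>x\<in>D. \<chi> (c * (v * x))) = (\<Sum>c\<in>F - {0}. \<Sum>x\<in>D. \<chi> (v * x))"
  proof (rule sum.cong[OF refl])
    fix c assume c: "c \<in> F - {0}"
    then have "inverse c \<in> F" "inverse c \<noteq> 0" using F_inverse by auto
    then show "(\<Sum>x\<in>D. \<chi> (c * (v * x))) = (\<Sum>x\<in>D. \<chi> (v * x))"
      using c assms
      by (intro sum.reindex_bij_witness[of _ "\<lambda>x. inverse c * x" "\<lambda>x. c * x"])
         (auto simp: mult.left_commute simp flip: mult.assoc)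
  qed
  also have "\<dots> = of_nat (q - 1) * (\<Sum>x\<in>D. \<chi> (v * x))" using F_0 card_F by simp
  finally show ?thesis .
qed

text \<open>Multiplication by a unit of \<open>F\<close> thus shifts exponents of
  \<open>\<gamma>\<close> by multiples of the step of the map \<open>\<rho>\<close>, which is how
  invariance of \<open>J\<close> becomes invariance of \<open>D\<close>.\<close>

lemma F_unit_is_power:
  assumes "a \<in> F" "a \<noteq> 0"
  obtains k where "a = \<gamma> ^ (k * ((CARD('a) - 1) div (q - 1)))"
proof -
  have "(CARD('a) - 1) div (q - 1) * (q - 1) = CARD('a) - 1"
    using minus_1_dvd_power_minus_1_nat[of q m] by (simp add: card_eq_q)
  then obtain y where "y \<noteq> 0" "a = y ^ ((CARD('a) - 1) div (q - 1))"
    using root_of_unity_is_power F_unit_power[OF assms] by metis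
  moreover obtain k where "y = \<gamma> ^ k" using \<open>y \<noteq> 0\<close> by (rule obtain_power)
  ultimately show thesis using that by (simp flip: power_mult)
qed

end

text \<open>\<open>\<omega>\<close> is the density of \<open>D\<close> among the nonzero elements,
  \<open>u / N\<close> in the application. The assumptions \<open>density_odd\<close> and
  \<open>density_even\<close> are the conditions (1) and (2) on \<open>u\<close> with denominators
  cleared; \<open>s_neq_4\<close> reflects \<open>(m, q) \<noteq> (4, 2)\<close>.\<close>

locale code_set = semiprimitive_subfield \<gamma> p l t F e q m
  for \<gamma> :: "'a::finite_field" and p l t F e q m +
  fixes D :: "'a set" and \<omega> :: real
  assumes zero_notin_D: "0 \<notin> D"
    and D_F: "c \<in> F \<Longrightarrow> c \<noteq> 0 \<Longrightarrow> x \<in> D \<Longrightarrow> c * x \<in> D"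
    and D_power: "x \<in> D \<Longrightarrow> y \<noteq> 0 \<Longrightarrow> x * y ^ (r + 1) \<in> D"
    and s_ge: "q\<^sup>2 \<le> s" and s_neq_4: "q = 2 \<Longrightarrow> s \<noteq> 4"
    and card_D: "real (card D) = \<omega> * (real s ^ 2 - 1)" and density_less_1: "\<omega> < 1"
    and density_odd: "odd t \<Longrightarrow> \<omega> * (real s + 1) > 1" "odd t \<Longrightarrow> \<omega> * (real s + 1) \<noteq> real s"
    and density_even: "even t \<Longrightarrow> \<omega> * (real s - 1) * (real s + real q) > (real q - 1) * real s"
begin

definition h :: "'a \<Rightarrow> nat" where "h v = card {x \<in> D. T (v * x) = 0}"

lemma s_gt_q: "real s > real q"
proof -
  have "q * 2 \<le> q * q" using q_ge_2 by (intro mult_le_mono2)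
  then have "q < s" using s_ge q_ge_2 unfolding power2_eq_square by linarith
  then show ?thesis by simp
qed

lemma h_eq:
  assumes "v \<noteq> 0"
  obtains \<delta> where "\<delta> = 0 \<or> \<delta> = 1"
    "real q * real (h v) = real (card D)
      + (real q - 1) * (\<omega> * ((- 1) ^ t * real s - 1) - (- 1) ^ t * real s * \<delta>)"
proof -
  have pos: "real s ^ 2 - 1 > 0"
  proof -
    have "1 < s" using s_gt_q q_ge_2 by simp
    then show ?thesis by simp
  qed
  obtain \<delta> :: real where \<delta>: "\<delta> = 0 \<or> \<delta> = 1" "(\<Sum>x\<in>D. \<chi> (v * x))
      = of_real (real (card D) / (real s ^ 2 - 1) * ((- 1) ^ t * real s - 1) - (- 1) ^ t * real s * \<delta>)"
    using character_sum_invariant_set[OF zero_notin_D D_power assms] by blast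
  have \<omega>: "real (card D) / (real s ^ 2 - 1) = \<omega>" using pos by (simp add: card_D)
  have "complex_of_real (real q * real (h v)) = of_nat (q * card {x \<in> D. T (v * x) = 0})"
    by (simp add: h_def)
  also have "\<dots> = of_nat (card D) + of_nat (q - 1) * (\<Sum>x\<in>D. \<chi> (v * x))"
    by (rule card_invariant_hyperplane) (rule D_F)
  also have "\<dots> = of_real (real (card D)
      + (real q - 1) * (\<omega> * ((- 1) ^ t * real s - 1) - (- 1) ^ t * real s * \<delta>))"
    unfolding \<delta>(2) \<omega> using q_ge_2 by (simp add: of_nat_diff)
  finally show thesis by (intro that[OF \<delta>(1)]) (simp only: of_real_eq_iff)
qed

text \<open>With \<open>U = \<omega> * (s + 1)\<close> or \<open>V = \<omega> * (s - 1)\<close>,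
  according to the parity of \<open>t\<close>, one factor of \<open>s\<^sup>2 - 1\<close> is
  absorbed and the main term of \<open>h\<close> factorises. Each later count is then a linear
  comparison in \<open>U\<close> or \<open>V\<close>.\<close>

lemma h_cases:
  obtains (odd) U where "1 < U" "U < real s + 1" "U \<noteq> real s" "real (card D) = U * (real s - 1)"
      "\<And>v. v \<noteq> 0 \<Longrightarrow> \<exists>\<delta>. (\<delta> = 0 \<or> \<delta> = 1) \<and>
        real q * real (h v) = U * (real s - real q) + (real q - 1) * real s * \<delta>"
  | (even) V where "(real q - 1) * real s < V * (real s + real q)" "V < real s - 1" "0 < V"
      "real (card D) = V * (real s + 1)"
      "\<And>v. v \<noteq> 0 \<Longrightarrow> \<exists>\<delta>. (\<delta> = 0 \<or> \<delta> = 1) \<and>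
        real q * real (h v) = V * (real s + real q) - (real q - 1) * real s * \<delta>"
proof (cases "odd t")
  case True
  show thesis
  proof (rule odd[of "\<omega> * (real s + 1)"])
    show "1 < \<omega> * (real s + 1)" "\<omega> * (real s + 1) \<noteq> real s"
      using density_odd True by auto
    show "\<omega> * (real s + 1) < real s + 1" using density_less_1 by simp
    show "real (card D) = \<omega> * (real s + 1) * (real s - 1)"
      by (simp add: card_D power2_eq_square algebra_simps)
    fix v :: 'a assume "v \<noteq> 0"
    then obtain \<delta> where \<delta>: "\<delta> = 0 \<or> \<delta> = 1" "real q * real (h v) = real (card D)
      + (real q - 1) * (\<omega> * ((- 1) ^ t * real s - 1) - (- 1) ^ t * real s * \<delta>)"
      by (rule h_eq)
    show "\<exists>\<delta>. (\<delta> = 0 \<or> \<delta> = 1) \<and>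
        real q * real (h v) = \<omega> * (real s + 1) * (real s - real q) + (real q - 1) * real s * \<delta>"
    proof (intro exI[of _ \<delta>] conjI)
      show "real q * real (h v) = \<omega> * (real s + 1) * (real s - real q) + (real q - 1) * real s * \<delta>"
        unfolding \<delta>(2) card_D using True by (simp add: power2_eq_square algebra_simps)
    qed (rule \<delta>(1))
  qed
next
  case False
  then have even_t: "even t" by simp
  show thesis
  proof (rule even[of "\<omega> * (real s - 1)"])
    show "(real q - 1) * real s < \<omega> * (real s - 1) * (real s + real q)"
      by (rule density_even[OF even_t])
    show "\<omega> * (real s - 1) < real s - 1" using density_less_1 s_gt_q q_ge_2 by simp
    have "0 < (real q - 1) * real s" using q_ge_2 s_pos by simp
    then have "0 < \<omega> * (real s - 1) * (real s + real q)" using density_even[OF even_t] by linarith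
    then show "0 < \<omega> * (real s - 1)" by (rule zero_less_mult_pos2) (use s_pos in simp)
    show "real (card D) = \<omega> * (real s - 1) * (real s + 1)"
      by (simp add: card_D power2_eq_square algebra_simps)
    fix v :: 'a assume "v \<noteq> 0"
    then obtain \<delta> where \<delta>: "\<delta> = 0 \<or> \<delta> = 1" "real q * real (h v) = real (card D)
      + (real q - 1) * (\<omega> * ((- 1) ^ t * real s - 1) - (- 1) ^ t * real s * \<delta>)"
      by (rule h_eq)
    show "\<exists>\<delta>. (\<delta> = 0 \<or> \<delta> = 1) \<and>
        real q * real (h v) = \<omega> * (real s - 1) * (real s + real q) - (real q - 1) * real s * \<delta>"
    proof (intro exI[of _ \<delta>] conjI)
      show "real q * real (h v) = \<omega> * (real s - 1) * (real s + real q) - (real q - 1) * real s * \<delta>"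
        unfolding \<delta>(2) card_D using even_t by (simp add: power2_eq_square algebra_simps)
    qed (rule \<delta>(1))
  qed
qed

section \<open>Positions of \<open>D\<close> excluded by counting\<close>

lemma q_s_pos: "(real q - 1) * real s > 0"
  using q_ge_2 s_pos by simp

text \<open>\<open>D\<close> meets every hyperplane. For even \<open>t\<close> the bound in
  condition (2) says exactly that the smaller of the two possible values is positive.\<close>

lemma h_pos:
  assumes "v \<noteq> 0"
  shows "h v \<noteq> 0"
proof (cases rule: h_cases)
  case (odd U)
  then obtain \<delta> where \<delta>: "\<delta> = 0 \<or> \<delta> = 1"
    "real q * real (h v) = U * (real s - real q) + (real q - 1) * real s * \<delta>" using assms by blast
  have "U * (real s - real q) > 0" using odd s_gt_q by simp
  then have "real q * real (h v) > 0" using \<delta> q_s_pos by auto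
  then show ?thesis by (intro notI) simp
next
  case (even V)
  then obtain \<delta> where "\<delta> = 0 \<or> \<delta> = 1"
    "real q * real (h v) = V * (real s + real q) - (real q - 1) * real s * \<delta>" using assms by blast
  then have "real q * real (h v) > 0" using even(1) q_s_pos by auto
  then show ?thesis by (intro notI) simp
qed

text \<open>Otherwise the hyperplane is the disjoint union of its section with \<open>D\<close> and
  the whole complement of \<open>D\<close>. Its size then forces \<open>U\<close> to be
  \<open>s\<close> or \<open>s + 1\<close>, or \<open>V\<close> to be \<open>s\<close> or
  \<open>s - 1\<close>; the value \<open>U = s\<close> is the one removed by the inequation in
  condition (1).\<close>

lemma complement_not_in_hyperplane:
  assumes "v \<noteq> 0"
  shows "\<exists>x. x \<noteq> 0 \<and> x \<notin> D \<and> T (v * x) \<noteq> 0"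
proof (rule ccontr)
  assume "\<not> ?thesis"
  then have "T (v * x) = 0" if "x \<notin> D" for x using that by (cases "x = 0") auto
  then have "{x. T (v * x) = 0} = {x \<in> D. T (v * x) = 0} \<union> (UNIV - D)" by auto
  moreover have "card ({x \<in> D. T (v * x) = 0} \<union> (UNIV - D)) = h v + (CARD('a) - card D)"
    unfolding h_def by (subst card_Un_disjoint) (auto simp: card_Diff_subset)
  ultimately have "q * (h v + (CARD('a) - card D)) = CARD('a)"
    using card_hyperplane[OF assms] by simp
  then have "real (q * (h v + (CARD('a) - card D))) = real CARD('a)" by (simp only:)
  then have eq: "real q * real (h v) + real q * (real s ^ 2 - real (card D)) = real s ^ 2"
    using card_mono[of UNIV D] by (simp add: card_eq_s of_nat_diff algebra_simps)
  show False
  proof (cases rule: h_cases)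
    case (odd U)
    then obtain \<delta> where \<delta>: "\<delta> = 0 \<or> \<delta> = 1"
      "real q * real (h v) = U * (real s - real q) + (real q - 1) * real s * \<delta>" using assms by blast
    have "(real q - 1) * real s * (s + \<delta> - U) = 0"
      using eq unfolding \<delta> odd(4) by (simp add: algebra_simps power2_eq_square)
    then show False using q_s_pos \<delta>(1) odd by auto
  next
    case (even V)
    then obtain \<delta> where \<delta>: "\<delta> = 0 \<or> \<delta> = 1"
      "real q * real (h v) = V * (real s + real q) - (real q - 1) * real s * \<delta>" using assms by blast
    have "(real q - 1) * real s * (s - \<delta> - V) = 0"
      using eq unfolding \<delta> even(4) by (simp add: algebra_simps power2_eq_square)
    then show False using q_s_pos \<delta>(1) even by auto
  qed
qed

text \<open>Containment would give \<open>U = \<delta>\<close> or \<open>V = - \<delta>\<close>,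
  against \<open>U > 1\<close> and \<open>V > 0\<close>.\<close>

lemma not_in_hyperplane:
  assumes "v \<noteq> 0"
  shows "\<exists>x\<in>D. T (v * x) \<noteq> 0"
proof (rule ccontr)
  assume "\<not> ?thesis"
  then have "{x \<in> D. T (v * x) = 0} = D" by auto
  then have eq: "h v = card D" by (simp add: h_def)
  show False
  proof (cases rule: h_cases)
    case (odd U)
    then obtain \<delta> where \<delta>: "\<delta> = 0 \<or> \<delta> = 1"
      "real q * real (h v) = U * (real s - real q) + (real q - 1) * real s * \<delta>" using assms by blast
    have "(real q - 1) * real s * (U - \<delta>) = 0"
      using \<delta>(2) unfolding eq odd(4) by (simp add: algebra_simps)
    then show False using q_s_pos \<delta>(1) odd by auto
  next
    case (even V)
    then obtain \<delta> where \<delta>: "\<delta> = 0 \<or> \<delta> = 1"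
      "real q * real (h v) = V * (real s + real q) - (real q - 1) * real s * \<delta>" using assms by blast
    have "(real q - 1) * real s * (V + \<delta>) = 0"
      using \<delta>(2) unfolding eq even(4) by (simp add: algebra_simps)
    then show False using q_s_pos \<delta>(1) even by auto
  qed
qed

lemma h_diff_le:
  assumes "v \<noteq> 0" "w \<noteq> 0"
  shows "real q * (real (h v) - real (h w)) \<le> (real q - 1) * real s"
proof (cases rule: h_cases)
  case (odd U)
  then obtain \<delta> \<delta>' where
    "\<delta> = 0 \<or> \<delta> = 1" "real q * real (h v) = U * (real s - real q) + (real q - 1) * real s * \<delta>"
    "\<delta>' = 0 \<or> \<delta>' = 1" "real q * real (h w) = U * (real s - real q) + (real q - 1) * real s * \<delta>'"
    using assms by blast
  then show ?thesis using q_s_pos by (auto simp: right_diff_distrib)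
next
  case (even V)
  then obtain \<delta> \<delta>' where
    "\<delta> = 0 \<or> \<delta> = 1" "real q * real (h v) = V * (real s + real q) - (real q - 1) * real s * \<delta>"
    "\<delta>' = 0 \<or> \<delta>' = 1" "real q * real (h w) = V * (real s + real q) - (real q - 1) * real s * \<delta>'"
    using assms by blast
  then show ?thesis using q_s_pos by (auto simp: right_diff_distrib)
qed

lemma card_hyperplane_diff:
  assumes "v \<noteq> 0" "\<And>c. c \<in> F \<Longrightarrow> w \<noteq> c * v"
  shows "real q * real q * real (card {x. T (v * x) = 0 \<and> T (w * x) \<noteq> 0}) = (real q - 1) * real s ^ 2"
proof -
  have "{x. T (v * x) = 0} = {x. T (v * x) = 0 \<and> T (w * x) = 0} \<union> {x. T (v * x) = 0 \<and> T (w * x) \<noteq> 0}"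
    by auto
  then have card_eq: "card {x. T (v * x) = 0} = card {x. T (v * x) = 0 \<and> T (w * x) = 0}
      + card {x. T (v * x) = 0 \<and> T (w * x) \<noteq> 0}"
    by (metis (no_types, lifting) card_Un_disjoint finite disjoint_iff mem_Collect_eq)
  have hyperplane: "real q * real (card {x. T (v * x) = 0}) = real s ^ 2"
    using arg_cong[OF card_hyperplane[OF assms(1)], of real] by (simp add: card_eq_s)
  have Int: "real q * real q * real (card {x. T (v * x) = 0 \<and> T (w * x) = 0}) = real s ^ 2"
    using arg_cong[OF card_hyperplane_Int[OF assms], of real] by (simp add: card_eq_s)
  have "real q * real q * real (card {x. T (v * x) = 0 \<and> T (w * x) \<noteq> 0})
      = real q * (real q * real (card {x. T (v * x) = 0}))
        - real q * real q * real (card {x. T (v * x) = 0 \<and> T (w * x) = 0})"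
    unfolding card_eq of_nat_add by (simp only: distrib_left mult.assoc add_diff_cancel_left')
  also have "\<dots> = (real q - 1) * real s ^ 2"
    unfolding hyperplane Int by (simp add: left_diff_distrib)
  finally show ?thesis .
qed

text \<open>If \<open>v\<close> and \<open>w\<close> are dependent, \<open>D\<close> would lie in a
  hyperplane. Otherwise the sections at \<open>v\<close> and \<open>v + w\<close> differ by
  \<open>(q - 1) * s\<^sup>2 / q\<^sup>2\<close> points, more than the gap
  \<open>(q - 1) * s / q\<close> between the two possible values, since
  \<open>s > q\<close>.\<close>

lemma not_confined_by_two_hyperplanes:
  assumes "v \<noteq> 0" "w \<noteq> 0"
    and in_D: "\<And>x. x \<in> D \<Longrightarrow> T (v * x) \<noteq> 0 \<Longrightarrow> T (w * x) = 0"
    and notin_D: "\<And>x. x \<notin> D \<Longrightarrow> x \<noteq> 0 \<Longrightarrow> T (v * x) = 0 \<Longrightarrow> T (w * x) = 0"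
  shows False
proof (cases "\<exists>c\<in>F. w = c * v")
  case True
  then obtain c where c: "c \<in> F" "w = c * v" by blast
  then have "c \<noteq> 0" using assms(2) by auto
  obtain x where "x \<in> D" "T (v * x) \<noteq> 0" using not_in_hyperplane[OF assms(1)] by blast
  then show False using in_D c \<open>c \<noteq> 0\<close> T_mult by (simp add: mult.assoc)
next
  case False
  then have indep: "\<And>c. c \<in> F \<Longrightarrow> w \<noteq> c * v" by blast
  have "v + w \<noteq> 0"
    using indep[of "- 1"] F_uminus[OF F_1] by (auto simp: add_eq_0_iff)
  \<comment> \<open>On \<open>D\<close> at least one of the two traces vanishes, so their sum
    vanishes only if both do.\<close>
  have "{x \<in> D. T ((v + w) * x) = 0} = {x \<in> D. T (v * x) = 0 \<and> T (w * x) = 0}"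
  proof (rule Collect_cong)
    fix x
    show "x \<in> D \<and> T ((v + w) * x) = 0 \<longleftrightarrow> x \<in> D \<and> T (v * x) = 0 \<and> T (w * x) = 0"
      using in_D[of x] by (cases "T (v * x) = 0") (auto simp: distrib_right T_add)
  qed
  \<comment> \<open>By \<open>notin_D\<close>, the points of the hyperplane of \<open>v\<close>
    outside that of \<open>w\<close> all belong to \<open>D\<close>.\<close>
  moreover have "{x \<in> D. T (v * x) = 0}
      = {x \<in> D. T (v * x) = 0 \<and> T (w * x) = 0} \<union> {x. T (v * x) = 0 \<and> T (w * x) \<noteq> 0}"
    using notin_D by force
  then have "h v = card {x \<in> D. T (v * x) = 0 \<and> T (w * x) = 0} + card {x. T (v * x) = 0 \<and> T (w * x) \<noteq> 0}"
    unfolding h_def by (simp add: card_Un_disjoint disjoint_iff)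
  ultimately have "real (h v) - real (h (v + w)) = card {x. T (v * x) = 0 \<and> T (w * x) \<noteq> 0}"
    unfolding h_def by simp
  then have "real q * (real q * (real (h v) - real (h (v + w)))) = (real q - 1) * real s ^ 2"
    using card_hyperplane_diff[OF assms(1) indep] by (simp add: mult.assoc)
  moreover have "real q * (real q * (real (h v) - real (h (v + w)))) \<le> real q * ((real q - 1) * real s)"
    using h_diff_le[OF assms(1) \<open>v + w \<noteq> 0\<close>] by (intro mult_left_mono) auto
  moreover have "real q * ((real q - 1) * real s) < real s * ((real q - 1) * real s)"
    using s_gt_q q_s_pos by (intro mult_strict_right_mono)
  ultimately show False by (simp add: power2_eq_square mult_ac)
qed

text \<open>Over two elements, one of the traces at \<open>v\<close>, \<open>w\<close> and
  \<open>v + w\<close> always vanishes, and \<open>eq\<close> makes the three sections of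
  \<open>D\<close> disjoint. Hence \<open>D\<close> has \<open>h v + h w + h (v + w)\<close>
  elements, while \<open>4 * h v = s\<^sup>2\<close>; the values in \<open>h_cases\<close> do not
  allow both.\<close>

lemma binary_affine_hyperplane:
  assumes "q = 2" "v \<noteq> 0" and indep: "\<And>c. c \<in> F \<Longrightarrow> w \<noteq> c * v"
    and eq: "{x \<in> D. T (v * x) = 0} = {x. T (v * x) = 0 \<and> T (w * x) \<noteq> 0}"
  shows False
proof -
  have "w \<noteq> 0" using indep[OF F_0] by simp
  have "v + w \<noteq> 0"
    using indep[of "- 1"] F_uminus[OF F_1] by (auto simp: add_eq_0_iff)
  \<comment> \<open>At \<open>s = 4\<close> the final inequalities of both cases would be
    satisfiable, so the excluded pair \<open>(m, q) = (4, 2)\<close> matters here.\<close>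
  have s5: "real s \<ge> 5"
  proof -
    have "s \<ge> 4" "s \<noteq> 4" using s_ge s_neq_4 \<open>q = 2\<close> by auto
    then show ?thesis by simp
  qed
  have F_nz: "a = 1" if "a \<in> F" "a \<noteq> 0" for a
    using F_unit_power[OF that] \<open>q = 2\<close> by simp
  have T_cases: "T x = 0 \<or> T x = 1" for x using F_nz T_in_F by blast
  have "(1::'a) + 1 = 0" using F_nz[OF F_add[OF F_1 F_1]] by (metis add_cancel_left_right zero_neq_one)
  then have T_add_cases: "T ((v + w) * x) = 0 \<longleftrightarrow> T (v * x) = T (w * x)" for x
    using T_cases[of "v * x"] T_cases[of "w * x"] by (auto simp: distrib_right T_add)
  have "D = {x \<in> D. T (v * x) = 0} \<union> {x \<in> D. T (w * x) = 0} \<union> {x \<in> D. T ((v + w) * x) = 0}"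
  proof (intro equalityI subsetI)
    fix x assume "x \<in> D"
    then show "x \<in> {x \<in> D. T (v * x) = 0} \<union> {x \<in> D. T (w * x) = 0} \<union> {x \<in> D. T ((v + w) * x) = 0}"
      using T_cases[of "v * x"] T_cases[of "w * x"] T_add_cases[of x] by auto
  qed auto
  moreover have "card \<dots> = h v + h w + h (v + w)"
  proof -
    have disj: "T (w * x) \<noteq> 0" if "x \<in> D" "T (v * x) = 0" for x
    proof -
      have "x \<in> {x \<in> D. T (v * x) = 0}" using that by simp
      then show ?thesis unfolding eq by simp
    qed
    have "{x \<in> D. T (v * x) = 0} \<inter> {x \<in> D. T (w * x) = 0} = {}" using disj by auto
    moreover have "({x \<in> D. T (v * x) = 0} \<union> {x \<in> D. T (w * x) = 0}) \<inter> {x \<in> D. T ((v + w) * x) = 0} = {}"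
      using disj unfolding T_add_cases by auto
    ultimately show ?thesis unfolding h_def by (simp add: card_Un_disjoint)
  qed
  ultimately have "card D = h v + h w + h (v + w)" by simp
  then have sum_eq: "2 * real (card D) = 2 * real (h v) + 2 * real (h w) + 2 * real (h (v + w))" by simp
  have "4 * real (h v) = real s ^ 2"
    using card_hyperplane_diff[OF \<open>v \<noteq> 0\<close> indep] unfolding h_def eq by (simp add: \<open>q = 2\<close>)
  show False
  proof (cases rule: h_cases)
    case (odd U)
    have h_ge: "2 * real (h u) \<ge> U * (real s - 2)" if "u \<noteq> 0" for u
      using odd(5)[OF that] \<open>q = 2\<close> by auto
    have "U * (real s - 4) \<le> 0"
      using sum_eq h_ge[OF \<open>v \<noteq> 0\<close>] h_ge[OF \<open>w \<noteq> 0\<close>] h_ge[OF \<open>v + w \<noteq> 0\<close>] odd(4)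
      by (simp add: algebra_simps)
    moreover have "U * (real s - 4) > 0" using odd(1) s5 by simp
    ultimately show False by simp
  next
    case (even V)
    have h_bounds: "2 * real (h u) \<ge> V * (real s + 2) - real s" "2 * real (h u) \<le> V * (real s + 2)"
      if "u \<noteq> 0" for u using even(5)[OF that] \<open>q = 2\<close> by auto
    have V_le: "V * (real s + 4) \<le> 3 * real s"
      using sum_eq h_bounds(1)[OF \<open>v \<noteq> 0\<close>] h_bounds(1)[OF \<open>w \<noteq> 0\<close>] h_bounds(1)[OF \<open>v + w \<noteq> 0\<close>] even(4)
      by (simp add: algebra_simps)
    have "real s * (real s * (real s + 4)) = 4 * real (h v) * (real s + 4)"
      using \<open>4 * real (h v) = real s ^ 2\<close> by (simp add: power2_eq_square)
    also have "\<dots> \<le> (2 * (V * (real s + 2))) * (real s + 4)"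
      using h_bounds(2)[OF \<open>v \<noteq> 0\<close>] by (intro mult_right_mono) auto
    also have "\<dots> = 2 * (real s + 2) * (V * (real s + 4))" by simp
    also have "\<dots> \<le> 2 * (real s + 2) * (3 * real s)" using V_le by (intro mult_left_mono) auto
    finally have "real s * (real s * (real s + 4)) \<le> real s * (6 * (real s + 2))"
      by (simp add: algebra_simps)
    then have "real s * (real s + 4) \<le> 6 * (real s + 2)" using s_pos by simp
    moreover have "real s * 9 \<le> real s * (real s + 4)" using s5 by (intro mult_left_mono) auto
    ultimately have "real s * 9 \<le> 6 * (real s + 2)" by (rule order_trans[rotated])
    then show False using s5 by simp
  qed
qed

end

section \<open>Minimality of the code\<close>

context code_set
begin

definition ind :: "'a \<Rightarrow> 'a" where "ind x = indicator D x"

lemma ind_simps [simp]: "x \<in> D \<Longrightarrow> ind x = 1" "x \<notin> D \<Longrightarrow> ind x = 0"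
  by (auto simp: ind_def)

text \<open>Subtracting \<open>b / a\<close> times the first word leaves the pure trace word of
  \<open>w'\<close>. If \<open>w'\<close> were nonzero, \<open>v\<close> and \<open>w'\<close> would
  confine \<open>D\<close> as in \<open>not_confined_by_two_hyperplanes\<close>, or for
  \<open>v = 0\<close> the complement of \<open>D\<close> would lie in the hyperplane of
  \<open>w'\<close>.\<close>

lemma minimality_nonzero:
  assumes "a \<in> F" "b \<in> F" "a \<noteq> 0"
    and supp: "\<And>x. x \<noteq> 0 \<Longrightarrow> a * ind x + T (v * x) = 0 \<Longrightarrow> b * ind x + T (w * x) = 0"
  shows "w = b / a * v"
proof (rule ccontr)
  define w' where "w' = w - b / a * v"
  have T_w': "T (w' * x) = T (w * x) - b / a * T (v * x)" for x
    using T_mult[OF F_divide[OF assms(2,1)], of "v * x"]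
    by (simp only: w'_def left_diff_distrib T_diff mult.assoc)
  assume "w \<noteq> b / a * v"
  then have "w' \<noteq> 0" by (simp add: w'_def)
  have notin_D: "T (w' * x) = 0" if "x \<notin> D" "x \<noteq> 0" "T (v * x) = 0" for x
    using supp[of x] that by (simp add: T_w')
  have in_D: "T (w' * x) = 0" if "x \<in> D" "T (v * x) \<noteq> 0" for x
  proof -
    \<comment> \<open>This scalar moves \<open>x\<close> within \<open>D\<close> to a zero of the
      first word.\<close>
    define c where "c = - a / T (v * x)"
    have c: "c \<in> F" "c \<noteq> 0"
      using that assms T_in_F by (auto simp: c_def intro!: F_divide F_uminus)
    have "x \<noteq> 0" using that zero_notin_D by auto
    have T_c: "T (u * (c * x)) = c * T (u * x)" for u
      using T_mult[OF c(1), of "u * x"] by (simp add: mult.left_commute)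
    have v: "T (v * (c * x)) = - a" using that by (simp only: T_c) (simp add: c_def)
    have "b + T (w * (c * x)) = 0"
      using supp[of "c * x"] D_F[OF c that(1)] c(2) \<open>x \<noteq> 0\<close> v by simp
    then have "T (w' * (c * x)) = 0"
      unfolding T_w' v using \<open>a \<noteq> 0\<close> by (simp add: add_eq_0_iff2)
    then show ?thesis using c(2) unfolding T_c by simp
  qed
  show False
  proof (cases "v = 0")
    case True
    then show False
      using complement_not_in_hyperplane[OF \<open>w' \<noteq> 0\<close>] notin_D by auto
  next
    case False
    then show False using not_confined_by_two_hyperplanes[OF _ \<open>w' \<noteq> 0\<close> in_D notin_D] by blast
  qed
qed

text \<open>For dependent \<open>v\<close> and \<open>w\<close>, a point of \<open>D\<close> on the
  hyperplane of \<open>v\<close>, supplied by \<open>h_pos\<close>, forces \<open>b = 0\<close>. For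
  independent ones, \<open>T (w * x)\<close> has the constant value \<open>- b\<close> wherever it
  is nonzero on the hyperplane; this forces \<open>q = 2\<close> and the position refuted by
  \<open>binary_affine_hyperplane\<close>.\<close>

lemma minimality_zero:
  assumes "b \<in> F" "v \<noteq> 0"
    and supp: "\<And>x. x \<noteq> 0 \<Longrightarrow> T (v * x) = 0 \<Longrightarrow> b * ind x + T (w * x) = 0"
  shows "b = 0 \<and> (\<exists>c\<in>F. w = c * v)"
proof (cases "\<exists>c\<in>F. w = c * v")
  case True
  then obtain c where c: "c \<in> F" "w = c * v" by blast
  have "{x \<in> D. T (v * x) = 0} \<noteq> {}" using h_pos[OF \<open>v \<noteq> 0\<close>] unfolding h_def by (metis card.empty)
  then obtain x where x: "x \<in> D" "T (v * x) = 0" by auto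
  moreover from this have "x \<noteq> 0" using zero_notin_D by auto
  ultimately have "b = 0" using supp[of x] T_mult[OF c(1)] c(2) by (simp add: mult.assoc)
  then show ?thesis using True by simp
next
  case False
  then have indep: "\<And>c. c \<in> F \<Longrightarrow> w \<noteq> c * v" by blast
  have in_D: "x \<in> D" if "T (v * x) = 0" "T (w * x) \<noteq> 0" for x
    using supp[of x] that by (cases "x = 0"; cases "x \<in> D") auto
  have "(real q - 1) * real s ^ 2 \<noteq> 0" using q_ge_2 s_pos by simp
  then have "{x. T (v * x) = 0 \<and> T (w * x) \<noteq> 0} \<noteq> {}"
    using card_hyperplane_diff[OF \<open>v \<noteq> 0\<close> indep] by (metis card.empty mult_zero_right of_nat_0)
  then obtain x where x: "T (v * x) = 0" "T (w * x) \<noteq> 0" by blast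
  have b_eq: "b = - T (w * y)" if "T (v * y) = 0" "T (w * y) \<noteq> 0" for y
    using supp[of y] that in_D[OF that] zero_notin_D by (metis add_eq_0_iff2 ind_simps(1) mult_1_right)
  then have "b \<noteq> 0" using x by force
  \<comment> \<open>Scaling \<open>x\<close> by \<open>c\<close> stays on the hyperplane and
    multiplies \<open>T (w * x)\<close> by \<open>c\<close>, yet the value must remain
    \<open>- b\<close>.\<close>
  have "c = 1" if c: "c \<in> F" "c \<noteq> 0" for c
  proof -
    have T_c: "T (u * (c * x)) = c * T (u * x)" for u
      using T_mult[OF c(1), of "u * x"] by (simp add: mult.left_commute)
    have "b = - T (w * (c * x))" by (rule b_eq) (use c x T_c in auto)
    then have "c * T (w * x) = T (w * x)" using b_eq[OF x] by (simp add: T_c)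
    then show ?thesis using x by simp
  qed
  then have "F = {0, 1}" using F_0 F_1 by auto
  then have "q = 2" using card_F by auto
  have "{x \<in> D. T (v * x) = 0} = {x. T (v * x) = 0 \<and> T (w * x) \<noteq> 0}"
  proof (intro equalityI subsetI)
    fix y assume y: "y \<in> {x \<in> D. T (v * x) = 0}"
    then have "y \<noteq> 0" using zero_notin_D by auto
    then show "y \<in> {x. T (v * x) = 0 \<and> T (w * x) \<noteq> 0}"
      using supp[of y] y \<open>b \<noteq> 0\<close> by auto
  qed (use in_D in auto)
  then show ?thesis using binary_affine_hyperplane[OF \<open>q = 2\<close> \<open>v \<noteq> 0\<close> indep] by blast
qed

lemma codeword_minimal:
  assumes "a \<in> F" "b \<in> F"
    and supp: "\<And>x. x \<noteq> 0 \<Longrightarrow> a * ind x + T (v * x) = 0 \<Longrightarrow> b * ind x + T (w * x) = 0"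
  shows "\<exists>c\<in>F. \<forall>x. x \<noteq> 0 \<longrightarrow> b * ind x + T (w * x) = c * (a * ind x + T (v * x))"
proof -
  consider "a \<noteq> 0" | "a = 0" "v \<noteq> 0" | "a = 0" "v = 0" by blast
  then show ?thesis
  proof cases
    case 1
    have c: "b / a \<in> F" using assms F_divide by blast
    have "w = b / a * v" using minimality_nonzero[OF assms(1,2) 1 supp] .
    then have "T (w * x) = b / a * T (v * x)" for x using T_mult[OF c] by (simp add: mult.assoc)
    then show ?thesis using 1 c by (intro bexI[of _ "b / a"]) (auto simp: distrib_left)
  next
    case 2
    then obtain c where "b = 0" "c \<in> F" "w = c * v"
      using minimality_zero[OF assms(2) 2(2), of w] supp by auto
    then show ?thesis using 2 T_mult by (intro bexI[of _ c]) (auto simp: mult.assoc)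
  next
    case 3
    then show ?thesis using supp F_0 by (intro bexI[of _ 0]) auto
  qed
qed

text \<open>Since \<open>x\<close> enumerates all nonzero elements, inclusion of supports says that
  every nonzero zero of the first word, as a function on the field, is a zero of the second, which
  is the hypothesis of \<open>codeword_minimal\<close>.\<close>

lemma code_minimal:
  assumes bij: "bij_betw x {..<q ^ m - 1} (UNIV - {0})"
  shows "minimal_linear_code F (q ^ m - 1) (code_of_set F q m x D)"
proof -
  define n where "n = q ^ m - 1"
  define cw where "cw a v = vec n (\<lambda>i. a * ind (x i) + T (v * x i))" for a v
  have code: "c \<in> code_of_set F q m x D \<longleftrightarrow> (\<exists>a v. a \<in> F \<and> c = cw a v)" for c
    unfolding code_of_set_def cw_def ind_def T_def n_def by auto
  have dim: "dim_vec (cw a v) = n" for a v by (simp add: cw_def)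
  have nth: "i < n \<Longrightarrow> cw a v $ i = a * ind (x i) + T (v * x i)" for a v i by (simp add: cw_def)
  have x_nz: "i < n \<Longrightarrow> x i \<noteq> 0" for i
    using bij bij_betwE by (fastforce simp: n_def)
  have ind_F: "ind y \<in> F" for y using F_0 F_1 by (cases "y \<in> D") auto
  have add: "cw a v + cw b w = cw (a + b) (v + w)" for a b v w
    by (rule eq_vecI) (auto simp: cw_def distrib_right T_add)
  have smult: "c \<cdot>\<^sub>v cw a v = cw (c * a) (c * v)" if "c \<in> F" for a v c
    by (rule eq_vecI) (use T_mult[OF that] in \<open>auto simp: cw_def distrib_left mult.assoc\<close>)
  have zero: "cw 0 0 = 0\<^sub>v n" by (rule eq_vecI) (auto simp: cw_def)
  have "linear_code F n (code_of_set F q m x D)"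
    unfolding linear_code_def
  proof (intro conjI ballI)
    fix c assume "c \<in> code_of_set F q m x D"
    then obtain a v where c: "a \<in> F" "c = cw a v" by (auto simp: code)
    show "c \<in> carrier_vec n" unfolding c(2) by (rule carrier_vecI) (rule dim)
    show "\<forall>i<n. c $ i \<in> F"
    proof (intro allI impI)
      fix i assume "i < n"
      show "c $ i \<in> F"
        unfolding c(2) nth[OF \<open>i < n\<close>] by (intro F_add F_mult c(1) ind_F T_in_F)
    qed
  next
    show "0\<^sub>v n \<in> code_of_set F q m x D" using F_0 zero unfolding code by metis
  next
    fix c d assume "c \<in> code_of_set F q m x D" "d \<in> code_of_set F q m x D"
    then show "c + d \<in> code_of_set F q m x D" unfolding code using add F_add by metis
  next
    fix k c assume "k \<in> F" "c \<in> code_of_set F q m x D"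
    then show "k \<cdot>\<^sub>v c \<in> code_of_set F q m x D" unfolding code using smult F_mult by metis
  qed
  moreover have "\<exists>k\<in>F. c' = k \<cdot>\<^sub>v c"
    if cc: "c \<in> code_of_set F q m x D" "c' \<in> code_of_set F q m x D" and supp: "vec_supp c' \<subseteq> vec_supp c"
    for c c'
  proof -
    obtain a v where c: "a \<in> F" "c = cw a v" using cc(1) by (auto simp: code)
    obtain b w where c': "b \<in> F" "c' = cw b w" using cc(2) by (auto simp: code)
    have zeros: "b * ind y + T (w * y) = 0" if y: "y \<noteq> 0" "a * ind y + T (v * y) = 0" for y
    proof (rule ccontr)
      assume nonzero: "b * ind y + T (w * y) \<noteq> 0"
      have "y \<in> x ` {..<n}" using bij y(1) by (simp add: bij_betw_def n_def)
      then obtain i where i: "i < n" "y = x i" by auto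
      then have "i \<in> vec_supp c'" using nonzero by (simp add: vec_supp_def c'(2) dim nth)
      then have "i \<in> vec_supp c" using supp by (rule rev_subsetD)
      then show False using i y(2) by (simp add: vec_supp_def c(2) dim nth)
    qed
    have "\<exists>k\<in>F. \<forall>y. y \<noteq> 0 \<longrightarrow> b * ind y + T (w * y) = k * (a * ind y + T (v * y))"
      by (rule codeword_minimal[OF c(1) c'(1)]) (rule zeros)
    then obtain k where k: "k \<in> F"
      "\<And>y. y \<noteq> 0 \<Longrightarrow> b * ind y + T (w * y) = k * (a * ind y + T (v * y))" by auto
    have "cw b w = k \<cdot>\<^sub>v cw a v"
    proof (rule eq_vecI)
      fix i assume "i < dim_vec (k \<cdot>\<^sub>v cw a v)"
      then have i: "i < n" by (simp add: dim)
      show "cw b w $ i = (k \<cdot>\<^sub>v cw a v) $ i"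
        using k(2)[OF x_nz[OF i]] i by (simp add: nth dim)
    qed (simp add: dim)
    then show ?thesis using k(1) unfolding c(2) c'(2) by (rule bexI)
  qed
  ultimately show ?thesis unfolding minimal_linear_code_def n_def by blast
qed

end

section \<open>Unions of cyclotomic classes\<close>

context field_generator
begin

text \<open>The exponent of \<open>\<gamma>\<close> is determined modulo the group order, hence
  modulo its divisor \<open>N\<close>.\<close>

lemma generator_power_in_cyclotomic_union:
  assumes "N dvd CARD('a) - 1" "J \<subseteq> {..<N}"
  shows "\<gamma> ^ k \<in> (\<Union>j\<in>J. cyclotomic_class \<gamma> N j) \<longleftrightarrow> k mod N \<in> J"
proof -
  obtain M where M: "CARD('a) - 1 = N * M" using assms(1) ..
  then have "N > 0" using card_field_gt_1 by (cases N) auto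
  show ?thesis
  proof
    assume "\<gamma> ^ k \<in> (\<Union>j\<in>J. cyclotomic_class \<gamma> N j)"
    then obtain i j where ij: "j \<in> J" "\<gamma> ^ k = \<gamma> ^ (i * N + j)"
      by (auto simp: cyclotomic_class_def)
    then have "[k = i * N + j] (mod N)"
      using generator_power_eq_iff cong_dvd_modulus_nat[OF _ assms(1)] by blast
    then have "k mod N = j mod N" by (simp add: cong_def)
    then show "k mod N \<in> J" using ij assms(2) by auto
  next
    assume k: "k mod N \<in> J"
    define k' where "k' = k mod (CARD('a) - 1)"
    have "k' < CARD('a) - 1" using card_field_gt_1 by (simp add: k'_def)
    then have "k' div N < M" using M by (simp add: less_mult_imp_div_less mult.commute)
    moreover have "k' mod N = k mod N" unfolding k'_def M by (rule mod_mod_cancel) simp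
    moreover have "\<gamma> ^ k = \<gamma> ^ (k' div N * N + k' mod N)"
      by (simp add: k'_def generator_power_mod)
    moreover have "(CARD('a) - 1) div N = M" using M \<open>N > 0\<close> by simp
    ultimately show "\<gamma> ^ k \<in> (\<Union>j\<in>J. cyclotomic_class \<gamma> N j)"
      using k unfolding cyclotomic_class_def by (metis (mono_tags, lifting) UN_I mem_Collect_eq)
  qed
qed

text \<open>The exponents \<open>i * N + j\<close> with \<open>j < N\<close> are distinct and lie
  below the group order, so no powers coincide.\<close>

lemma card_cyclotomic_union:
  assumes "N dvd CARD('a) - 1" "J \<subseteq> {..<N}"
  shows "card (\<Union>j\<in>J. cyclotomic_class \<gamma> N j) = card J * ((CARD('a) - 1) div N)"
proof -
  obtain M where M: "CARD('a) - 1 = N * M" using assms(1) ..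
  then have "N > 0" using card_field_gt_1 by (cases N) auto
  have div: "(CARD('a) - 1) div N = M" using M \<open>N > 0\<close> by simp
  have exponent_eq: "j = j' \<and> i = i'"
    if "j < N" "j' < N" "i < M" "i' < M" "\<gamma> ^ (i * N + j) = \<gamma> ^ (i' * N + j')" for i i' j j'
  proof -
    have less: "a * N + b < CARD('a) - 1" if "a < M" "b < N" for a b
    proof -
      have "a * N + b < Suc a * N" using that by simp
      also have "\<dots> \<le> M * N" using that by (intro mult_le_mono1) simp
      finally show ?thesis by (simp add: M mult.commute)
    qed
    have "i * N + j = i' * N + j'"
      using that less[of i j] less[of i' j'] generator_power_eq_iff cong_less_modulus_unique_nat by blast
    then have "(i * N + j) div N = (i' * N + j') div N" "(i * N + j) mod N = (i' * N + j') mod N"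
      by simp_all
    then show ?thesis using that \<open>N > 0\<close> by simp
  qed
  have "(\<Union>j\<in>J. cyclotomic_class \<gamma> N j) = (\<lambda>(j, i). \<gamma> ^ (i * N + j)) ` (J \<times> {..<M})"
    unfolding cyclotomic_class_def div by auto
  moreover have "inj_on (\<lambda>(j, i). \<gamma> ^ (i * N + j)) (J \<times> {..<M})"
  proof (rule inj_onI)
    fix a b assume ab: "a \<in> J \<times> {..<M}" "b \<in> J \<times> {..<M}"
      "(\<lambda>(j, i). \<gamma> ^ (i * N + j)) a = (\<lambda>(j, i). \<gamma> ^ (i * N + j)) b"
    then have "fst a < N" "fst b < N" "snd a < M" "snd b < M"
      "\<gamma> ^ (snd a * N + fst a) = \<gamma> ^ (snd b * N + fst b)"
      using assms(2) by (auto simp: case_prod_unfold mem_Times_iff)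
    then have "fst a = fst b \<and> snd a = snd b" by (rule exponent_eq)
    then show "a = b" by (simp add: prod_eq_iff)
  qed
  ultimately show ?thesis by (simp add: card_image div card_cartesian_product)
qed

end

theorem theorem6:
  fixes p e q m N l\<^sub>1 t u :: nat
    and F :: "'a::finite_field set"
    and \<gamma> :: 'a
    and J :: "nat set"
    and D :: "'a set"
    and x :: "nat \<Rightarrow> 'a"
  assumes "prime p" and "e \<ge> 1" and "q = p ^ e"
    and "m \<ge> 4" and "(m, q) \<noteq> (4, 2)" and "2 dvd e * m"
    and "CARD('a) = q ^ m"
    and "is_subfield F" and "card F = q"
    and "bij_betw x {..<q ^ m - 1} (UNIV - {0})"
    and "primitive_element \<gamma>"
    and "N dvd q ^ m - 1" and "N \<noteq> q ^ m - 1" and "N \<noteq> 1"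
    and "l\<^sub>1 > 0" and "[int p ^ l\<^sub>1 = - 1] (mod int N)"
    and "\<forall>l>0. [int p ^ l = - 1] (mod int N) \<longrightarrow> l\<^sub>1 \<le> l"
    and "e * m = 2 * l\<^sub>1 * t"
    and "J \<subset> {..<N}" and "card J = u"
    and "odd q \<longrightarrow> N dvd (q ^ m - 1) div 2 \<and> (\<lambda>j. (j + (q ^ m - 1) div 2) mod N) ` J = J"
    and "D = (\<Union>j\<in>J. cyclotomic_class \<gamma> N j)"
    and "(\<lambda>j. (j + (q ^ m - 1) div (q - 1)) mod N) ` J = J"
    and "(odd t \<and> real u \<noteq> sqrt (real (q ^ m)) * real N / (sqrt (real (q ^ m)) + 1)
            \<and> real u > real N / (sqrt (real (q ^ m)) + 1))
       \<or> (even t \<and> real u > (real q - 1) * sqrt (real (q ^ m)) * real N /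
            ((sqrt (real (q ^ m)) + real q) * (sqrt (real (q ^ m)) - 1)))"
  shows "minimal_linear_code F (q ^ m - 1) (code_of_set F q m x D)"
proof -
  have "t > 0" using assms(2,4,18) by (cases t) auto
  interpret semiprimitive_subfield \<gamma> p l\<^sub>1 t F e q m
    by unfold_locales (use assms \<open>t > 0\<close> in \<open>simp_all flip: power_mult\<close>)
  have card: "CARD('a) = q ^ m" by fact
  have N_dvd: "N dvd CARD('a) - 1" using assms(12) card by simp
  then have N_pos: "N > 0" using card_field_gt_1 by (cases N) auto
  have J: "J \<subseteq> {..<N}" using assms(19) by blast
  have mem_D: "\<gamma> ^ k \<in> D \<longleftrightarrow> k mod N \<in> J" for k
    unfolding assms(22) by (rule generator_power_in_cyclotomic_union[OF N_dvd J])
  have zero: "0 \<notin> D" unfolding assms(22) cyclotomic_class_def using generator_nonzero by auto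
  have obtain_D: "\<exists>k. x = \<gamma> ^ k \<and> k mod N \<in> J" if "x \<in> D" for x
    using that zero mem_D obtain_power[of x] by metis
  \<comment> \<open>Iterated invariance of \<open>J\<close> under \<open>\<rho>\<close>, for
    multiplication by units of \<open>F\<close>.\<close>
  have shift: "(k + i * ((q ^ m - 1) div (q - 1))) mod N \<in> J" if "k mod N \<in> J" for k i
  proof (induction i)
    case (Suc i)
    define a where "a = (q ^ m - 1) div (q - 1)"
    have "((k + i * a) mod N + a) mod N \<in> J"
      using Suc assms(23) unfolding a_def by blast
    then have "(k + i * a + a) mod N \<in> J" by (simp add: mod_add_left_eq)
    then show ?case by (simp add: a_def algebra_simps)
  qed (use that in simp)
  have "int N dvd int (r + 1)"
    using assms(16) by (simp add: cong_iff_dvd_diff r_def add.commute)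
  then have "N dvd r + 1" by (simp only: int_dvd_int_iff)
  have s2: "q ^ m = s\<^sup>2" using card card_eq_s by simp
  then have sqrt: "sqrt (real (q ^ m)) = real s" by simp
  \<comment> \<open>This is \<open>m \<ge> 4\<close>, read through
    \<open>s\<^sup>2 = q ^ m\<close>.\<close>
  have s_ge: "q\<^sup>2 \<le> s"
  proof -
    have "q ^ 4 \<le> q ^ m" using q_ge_2 assms(4) by (intro power_increasing) auto
    then have "(q\<^sup>2)\<^sup>2 \<le> s\<^sup>2" by (simp add: s2)
    then show ?thesis by (rule power2_le_imp_le) simp
  qed
  have "1 < s"
    using s_ge q_ge_2 power_increasing[of 1 2 q] by simp
  define \<omega> where "\<omega> = real u / real N"
  have card_D: "real (card D) = \<omega> * (real s ^ 2 - 1)"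
  proof -
    have "real ((CARD('a) - 1) div N) = (real s ^ 2 - 1) / real N"
      using N_dvd s_pos by (simp add: real_of_nat_div card_eq_s of_nat_diff)
    then show ?thesis
      unfolding assms(22) card_cyclotomic_union[OF N_dvd J] assms(20) by (simp add: \<omega>_def)
  qed
  have u_less: "u < N"
    using psubset_card_mono[OF _ assms(19)] assms(20) by simp
  interpret code_set \<gamma> p l\<^sub>1 t F e q m D \<omega>
  proof
    show "0 \<notin> D" by (rule zero)
    show "c * x \<in> D" if c: "c \<in> F" "c \<noteq> 0" "x \<in> D" for c x
    proof -
      obtain i where i: "c = \<gamma> ^ (i * ((CARD('a) - 1) div (q - 1)))"
        using F_unit_is_power[OF c(1,2)] .
      obtain k where k: "x = \<gamma> ^ k" "k mod N \<in> J" using obtain_D[OF c(3)] by blast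
      have "c * x = \<gamma> ^ (k + i * ((q ^ m - 1) div (q - 1)))"
        by (simp add: i k card power_add mult.commute)
      then show ?thesis using shift[OF k(2)] mem_D by metis
    qed
    show "x * y ^ (r + 1) \<in> D" if xy: "x \<in> D" "y \<noteq> 0" for x y
    proof -
      obtain k where k: "x = \<gamma> ^ k" "k mod N \<in> J" using obtain_D[OF xy(1)] by blast
      obtain i where i: "y = \<gamma> ^ i" using obtain_power[OF xy(2)] .
      have "x * y ^ (r + 1) = \<gamma> ^ (k + i * (r + 1))"
        unfolding i k by (simp only: power_add power_mult)
      \<comment> \<open>As \<open>N\<close> divides \<open>r + 1\<close>, multiplication by an
        \<open>(r + 1)\<close>-th power preserves each cyclotomic class.\<close>
      moreover have "(k + i * (r + 1)) mod N = k mod N"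
        using \<open>N dvd r + 1\<close> by (metis dvd_mult mod_add_right_eq dvd_imp_mod_0 add_0_right)
      ultimately show ?thesis using k(2) mem_D by metis
    qed
    show "q\<^sup>2 \<le> s" by (rule s_ge)
    show "s \<noteq> 4" if "q = 2"
    proof
      assume "s = 4"
      then have "(2::nat) ^ m = 2 ^ 4" using s2 that by simp
      then have "m = 4" by (subst (asm) power_inject_exp) auto
      then show False using assms(5) that by simp
    qed
    show "real (card D) = \<omega> * (real s ^ 2 - 1)" by (rule card_D)
    show "\<omega> < 1" using u_less by (simp add: \<omega>_def)
    show "1 < \<omega> * (real s + 1)" "\<omega> * (real s + 1) \<noteq> real s" if "odd t"
      using assms(24) that N_pos s_pos unfolding sqrt \<omega>_def by (auto simp: field_simps)
    show "(real q - 1) * real s < \<omega> * (real s - 1) * (real s + real q)" if "even t"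
    proof -
      have "(real q - 1) * real s * real N / ((real s + real q) * (real s - 1)) < real u"
        using assms(24) that unfolding sqrt by blast
      moreover have "(real s + real q) * (real s - 1) > 0" using \<open>1 < s\<close> by simp
      ultimately have "(real q - 1) * real s * real N < real u * ((real s + real q) * (real s - 1))"
        by (simp only: pos_divide_less_eq)
      then show ?thesis unfolding \<omega>_def using N_pos by (simp add: field_simps)
    qed
  qed
  show ?thesis using assms(10) by (rule code_minimal)
qed

end
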